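(* Let $l,m,n\ge 2$ be integers and let $\Delta(l,m,n)$ be the triangle Coxeter group with edge labels $l,m,n$. Then $\Delta(l,m,n)$ has Property (NL) if and only if it is not hyperbolic, i.e. if and only if it is not the case that $\frac{\pi}{l}+\frac{\pi}{m}+\frac{\pi}{n}<\pi$.
   Context: A triangle group is a Coxeter group whose defining graph has three vertices and three edges, with edges labelled by integers $l,m,n\ge 2$; it is denoted $\Delta(l,m,n)$ and has the presentation $\langle a,b,c \mid a^2=b^2=c^2=1,\ (ab)^l=(bc)^m=(ac)^n=1\rangle$. Put $s=\frac{\pi}{l}+\frac{\pi}{m}+\frac{\pi}{n}$. The triangle group is called Euclidean if $s=\pi$, spherical if $s>\pi$, and hyperbolic if $s<\pi$ (corresponding to whether the group is the reflection group of a triangle tiling of the Euclidean plane, the sphere, or the hyperbolic plane). A geodesic metric space $X$ is hyperbolic if there is $\delta\ge 0$ such that for all $x,y,z\in X$ and all geodesics $[x,y],[y,z],[x,z]$, the side $[x,z]$ is contained in the $\delta$-neighborhood of $[x,y]\cup[y,z]$. For an isometric action of a group $G$ on a (nonempty) hyperbolic space $X$, an element $g\in G$ is loxodromic if the map $\mathbb{Z}\to X$, $k\mapsto g^k x_0$, is a quasi-isometric embedding for some (equivalently, every) $x_0\in X$. Here a map $q:Y\to X$ of metric spaces is a quasi-isometric embedding if there is $C\ge 1$ with $\frac1C d_Y(a,b)-C\le d_X(q(a),q(b))\le C d_Y(a,b)+C$ for all $a,b\in Y$. A group $G$ has Property (NL) if for every isometric action of $G$ on every hyperbolic space, no element of $G$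 is loxodromic. *)

theory Defs
  imports "HOL-Analysis.Analysis" "HOL-Algebra.Group_Action"
begin

section \<open>Groups given by presentations\<close>

text \<open>A letter \<open>(True, x)\<close> stands for the generator \<open>x\<close> and \<open>(False, x)\<close> for its formal inverse.
  Every element of the type \<open>'g\<close> is a generator, and \<open>R\<close> is the set of relators.\<close>

type_synonym 'g word = "(bool \<times> 'g) list"

inductive word_equiv :: "'g word set \<Rightarrow> 'g word \<Rightarrow> 'g word \<Rightarrow> bool" for R where
  cancel: "word_equiv R (u @ [(e, x), (\<not> e, x)] @ v) (u @ v)"
| relator: "r \<in> R \<Longrightarrow> word_equiv R (u @ r @ v) (u @ v)"
| refl: "word_equiv R u u"
| sym: "word_equiv R u v \<Longrightarrow> word_equiv R v u"
| trans: "word_equiv R u v \<Longrightarrow> word_equiv R v w \<Longrightarrow> word_equiv R u w"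

definition word_rel :: "'g word set \<Rightarrow> ('g word \<times> 'g word) set" where
  "word_rel R = {(u, v). word_equiv R u v}"

definition presented_group :: "'g word set \<Rightarrow> 'g word set monoid" where
  "presented_group R =
     \<lparr>carrier = UNIV // word_rel R,
      mult = (\<lambda>U V. \<Union>u\<in>U. \<Union>v\<in>V. word_rel R `` {u @ v}),
      one = word_rel R `` {[]}\<rparr>"

lemma equiv_word_rel: "equiv UNIV (word_rel R)"
  by (rule equivI)
     (auto simp: word_rel_def refl_on_def sym_def trans_def intro: word_equiv.intros)

lemma word_equiv_context:
  "word_equiv R u v \<Longrightarrow> word_equiv R (p @ u @ q) (p @ v @ q)"
proof (induction rule: word_equiv.induct)
  case (cancel u e x v)
  show ?case using word_equiv.cancel[of R "p @ u" e x "v @ q"] by simp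
next
  case (relator r u v)
  then show ?case using word_equiv.relator[of r R "p @ u" "v @ q"] by simp
qed (blast intro: word_equiv.intros)+

lemma word_equiv_append:
  assumes "word_equiv R u u'" "word_equiv R v v'"
  shows "word_equiv R (u @ v) (u' @ v')"
  using word_equiv_context[OF assms(1), of "[]" v] word_equiv_context[OF assms(2), of u' "[]"]
  by (auto intro: word_equiv.trans)

lemma presented_group_mult:
  "word_rel R `` {u} \<otimes>\<^bsub>presented_group R\<^esub> word_rel R `` {v} = word_rel R `` {u @ v}"
proof -
  have "(\<lambda>u v. word_rel R `` {u @ v}) respects2 word_rel R"
    by (rule congruent2I', rule equiv_class_eq[OF equiv_word_rel])
       (simp add: word_rel_def word_equiv_append)
  then show ?thesis
    using UN_equiv_class2[OF equiv_word_rel equiv_word_rel] by (simp add: presented_group_def)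
qed

lemma word_equiv_inverse:
  "word_equiv R (rev (map (\<lambda>(e, x). (\<not> e, x)) w) @ w) []"
proof (induction w)
  case Nil
  show ?case by (simp add: word_equiv.refl)
next
  case (Cons a w)
  obtain e x where a: "a = (e, x)" by (cases a)
  show ?case
    using word_equiv.cancel[of R "rev (map (\<lambda>(e, x). (\<not> e, x)) w)" "\<not> e" x w] Cons
    by (auto simp: a intro: word_equiv.trans)
qed

lemma group_presented_group: "group (presented_group R)"
proof (rule groupI)
  have carrier: "carrier (presented_group R) = range (\<lambda>w. word_rel R `` {w})"
    by (auto simp: presented_group_def quotient_def)
  have one: "\<one>\<^bsub>presented_group R\<^esub> = word_rel R `` {[]}"
    by (simp add: presented_group_def)
  show "\<one>\<^bsub>presented_group R\<^esub> \<in> carrier (presented_group R)"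
    by (simp add: one carrier)
  fix U assume U: "U \<in> carrier (presented_group R)"
  then obtain u where u: "U = word_rel R `` {u}" by (auto simp: carrier)
  show "\<one>\<^bsub>presented_group R\<^esub> \<otimes>\<^bsub>presented_group R\<^esub> U = U"
    by (simp add: one u presented_group_mult)
  have "word_rel R `` {rev (map (\<lambda>(e, x). (\<not> e, x)) u) @ u} = word_rel R `` {[]}"
    using word_equiv_inverse[of R u]
    by (intro equiv_class_eq[OF equiv_word_rel]) (simp add: word_rel_def)
  then show "\<exists>V\<in>carrier (presented_group R). V \<otimes>\<^bsub>presented_group R\<^esub> U = \<one>\<^bsub>presented_group R\<^esub>"
    by (intro bexI[of _ "word_rel R `` {rev (map (\<lambda>(e, x). (\<not> e, x)) u)}"])
       (simp_all add: one carrier u presented_group_mult)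
  fix V assume "V \<in> carrier (presented_group R)"
  then obtain v where v: "V = word_rel R `` {v}" by (auto simp: carrier)
  show "U \<otimes>\<^bsub>presented_group R\<^esub> V \<in> carrier (presented_group R)"
    by (simp add: carrier u v presented_group_mult)
  fix W assume "W \<in> carrier (presented_group R)"
  then obtain w where w: "W = word_rel R `` {w}" by (auto simp: carrier)
  show "(U \<otimes>\<^bsub>presented_group R\<^esub> V) \<otimes>\<^bsub>presented_group R\<^esub> W
      = U \<otimes>\<^bsub>presented_group R\<^esub> (V \<otimes>\<^bsub>presented_group R\<^esub> W)"
    by (simp add: u v w presented_group_mult)
qed


section \<open>Triangle groups\<close>

datatype triangle_gen = Gen_a | Gen_b | Gen_c

definition word_power :: "'g word \<Rightarrow> nat \<Rightarrow> 'g word" where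
  "word_power w k = concat (replicate k w)"

definition triangle_relators :: "nat \<Rightarrow> nat \<Rightarrow> nat \<Rightarrow> triangle_gen word set" where
  "triangle_relators l m n =
     (let a = [(True, Gen_a)]; b = [(True, Gen_b)]; c = [(True, Gen_c)]
      in {word_power a 2, word_power b 2, word_power c 2,
          word_power (a @ b) l, word_power (b @ c) m, word_power (a @ c) n})"

definition triangle_group :: "nat \<Rightarrow> nat \<Rightarrow> nat \<Rightarrow> triangle_gen word set monoid" where
  "triangle_group l m n = presented_group (triangle_relators l m n)"

definition hyperbolic_triangle :: "nat \<Rightarrow> nat \<Rightarrow> nat \<Rightarrow> bool" where
  "hyperbolic_triangle l m n \<longleftrightarrow> pi / real l + pi / real m + pi / real n < pi"


section \<open>Hyperbolic metric spaces\<close>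

definition geodesic_segment :: "'x set \<Rightarrow> ('x \<Rightarrow> 'x \<Rightarrow> real) \<Rightarrow> 'x \<Rightarrow> 'x \<Rightarrow> 'x set \<Rightarrow> bool" where
  "geodesic_segment X d x y S \<longleftrightarrow>
     (\<exists>\<gamma>. \<gamma> \<in> {0..d x y} \<rightarrow> X \<and> \<gamma> 0 = x \<and> \<gamma> (d x y) = y \<and>
          (\<forall>s\<in>{0..d x y}. \<forall>t\<in>{0..d x y}. d (\<gamma> s) (\<gamma> t) = \<bar>s - t\<bar>) \<and>
          S = \<gamma> ` {0..d x y})"

definition geodesic_space :: "'x set \<Rightarrow> ('x \<Rightarrow> 'x \<Rightarrow> real) \<Rightarrow> bool" where
  "geodesic_space X d \<longleftrightarrow> Metric_space X d \<and> (\<forall>x\<in>X. \<forall>y\<in>X. \<exists>S. geodesic_segment X d x y S)"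

definition hyperbolic_space :: "'x set \<Rightarrow> ('x \<Rightarrow> 'x \<Rightarrow> real) \<Rightarrow> bool" where
  "hyperbolic_space X d \<longleftrightarrow> geodesic_space X d \<and>
     (\<exists>\<delta>\<ge>0. \<forall>x\<in>X. \<forall>y\<in>X. \<forall>z\<in>X. \<forall>P Q S.
        geodesic_segment X d x y P \<longrightarrow> geodesic_segment X d y z Q \<longrightarrow> geodesic_segment X d x z S \<longrightarrow>
        (\<forall>p\<in>S. \<exists>q\<in>P \<union> Q. d p q \<le> \<delta>))"

definition quasi_isometric_embedding ::
  "'y set \<Rightarrow> ('y \<Rightarrow> 'y \<Rightarrow> real) \<Rightarrow> 'x set \<Rightarrow> ('x \<Rightarrow> 'x \<Rightarrow> real) \<Rightarrow> ('y \<Rightarrow> 'x) \<Rightarrow> bool" where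
  "quasi_isometric_embedding Y dY X dX q \<longleftrightarrow> q \<in> Y \<rightarrow> X \<and>
     (\<exists>C\<ge>1. \<forall>a\<in>Y. \<forall>b\<in>Y. 1 / C * dY a b - C \<le> dX (q a) (q b) \<and> dX (q a) (q b) \<le> C * dY a b + C)"


section \<open>Property (NL)\<close>

definition isometric_action ::
  "('g, 'b) monoid_scheme \<Rightarrow> 'x set \<Rightarrow> ('x \<Rightarrow> 'x \<Rightarrow> real) \<Rightarrow> ('g \<Rightarrow> 'x \<Rightarrow> 'x) \<Rightarrow> bool" where
  "isometric_action G X d \<phi> \<longleftrightarrow> group_action G X \<phi> \<and>
     (\<forall>g\<in>carrier G. \<forall>x\<in>X. \<forall>y\<in>X. d (\<phi> g x) (\<phi> g y) = d x y)"

definition loxodromic ::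
  "('g, 'b) monoid_scheme \<Rightarrow> 'x set \<Rightarrow> ('x \<Rightarrow> 'x \<Rightarrow> real) \<Rightarrow> ('g \<Rightarrow> 'x \<Rightarrow> 'x) \<Rightarrow> 'g \<Rightarrow> bool" where
  "loxodromic G X d \<phi> g \<longleftrightarrow>
     (\<exists>x\<^sub>0\<in>X. quasi_isometric_embedding (UNIV :: int set) dist X d (\<lambda>k. \<phi> (g [^]\<^bsub>G\<^esub> k) x\<^sub>0))"

text \<open>HOL cannot quantify over all types inside a definition, so the type \<open>'x\<close> containing the points
  of the spaces is a parameter. The property for \<open>'x\<close> implies the property for every type that
  injects into \<open>'x\<close>. For a countable group it does not depend on \<open>'x\<close> as soon as \<open>'x\<close> has at least
  the cardinality of the continuum: given an action on a hyperbolic space with a loxodromic element,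
  close one orbit under translates of a choice of geodesic segments, countably many times; this
  is an invariant geodesic subspace with at most continuum many points. On a type that is too small
  (such as a countable one, whose geodesic spaces are single points) the property is vacuous.\<close>

definition property_NL :: "'x itself \<Rightarrow> ('g, 'b) monoid_scheme \<Rightarrow> bool" where
  "property_NL (_ :: 'x itself) G \<longleftrightarrow>
     (\<forall>(X :: 'x set) d \<phi>. X \<noteq> {} \<longrightarrow> hyperbolic_space X d \<longrightarrow> isometric_action G X d \<phi> \<longrightarrow>
        (\<forall>g\<in>carrier G. \<not> loxodromic G X d \<phi> g))"

end

theory Submission
  imports Defs "HOL-Real_Asymp.Real_Asymp"
begin

text \<open>The angles \<open>\<pi>/l\<close>, \<open>\<pi>/m\<close>, \<open>\<pi>/n\<close> decide in which geometry a triangle with these angles lives, and the two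
directions of the theorem use this geometry in different ways.

If the angle sum is less than \<open>\<pi>\<close>, the triangle lives in the hyperbolic plane and the group acts there by
reflections (\<open>exists_reflection_triangle\<close>). A reflection is given by a trace-free real matrix of
determinant \<open>- 1\<close>, and a product of two of them whose trace is \<open>- 2 * cos (\<pi>/k)\<close> induces a
transformation of order \<open>k\<close>. Three matrices with the prescribed pairwise traces exist because a
certain discriminant is positive, which is the angle condition (\<open>hyperbolic_angle_ineq\<close>). The same
discriminant is the square of the trace of \<open>abc\<close> up to a positive factor, so this product has a real
eigenvalue of modulus different from 1. It shifts a Busemann function, which is 1-Lipschitz, by a
nonzero constant, and is therefore loxodromic (\<open>loxodromic_if_lipschitz_translation\<close>). The plane
is hyperbolic by Ptolemy's inequality for complex numbers, which yields both the triangle inequality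
and the four-point inequality; the latter is equivalent to slimness of triangles.

If the angle sum is at least \<open>\<pi>\<close>, the labels are up to order \<open>(2,2,n)\<close>, \<open>(2,3,3)\<close>, \<open>(2,3,4)\<close>,
\<open>(2,3,5)\<close>, \<open>(2,3,6)\<close>, \<open>(2,4,4)\<close> or \<open>(3,3,3)\<close>. The groups \<open>(2,3,4)\<close> and \<open>(2,3,6)\<close> contain the groups
\<open>(2,3,3)\<close> and \<open>(3,3,3)\<close> with index two. The remaining spherical ones are finite, by enumeration of the
cosets of a dihedral subgroup. The groups \<open>(3,3,3)\<close> and \<open>(2,4,4)\<close> have a subgroup of translations of
finite index that is generated by two commuting elements \<open>t\<close>, \<open>u\<close> and is normalised by a rotation of
order 3 or 4 which takes \<open>t\<close> to \<open>u\<close>. On commuting isometries of a hyperbolic space the stable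
translation length behaves like the absolute value of a homomorphism to the reals:
the larger of its values on \<open>tu\<close> and \<open>t\<inverse>u\<close> is the sum of its values on \<open>t\<close> and \<open>u\<close>. As it is constant
on conjugacy classes, invariance under the rotation forces it to vanish. The proof works with
displacements of powers instead of limits: the displacement of \<open>t ^^ (2 * k)\<close> exceeds that of \<open>t ^^ k\<close>
by at most a constant (\<open>slow_if_rotated\<close>), so along powers of two it grows only logarithmically,
while a loxodromic element moves its base point at linear speed.\<close>

section \<open>The four-point inequality and slim triangles\<close>

text \<open>Gromov's four-point inequality, stated without a base point: among the three sums of opposite
distances the largest two differ by at most \<open>C\<close>.\<close>

definition four_point :: "'x set \<Rightarrow> ('x \<Rightarrow> 'x \<Rightarrow> real) \<Rightarrow> real \<Rightarrow> bool" where
  "four_point X d C \<longleftrightarrow> (\<forall>x\<in>X. \<forall>y\<in>X. \<forall>z\<in>X. \<forall>w\<in>X.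
     d x y + d z w \<le> max (d x z + d y w) (d x w + d y z) + C)"

lemma four_pointD:
  assumes "four_point X d C" "x \<in> X" "y \<in> X" "z \<in> X" "w \<in> X"
  shows "d x y + d z w \<le> max (d x z + d y w) (d x w + d y z) + C"
  using assms unfolding four_point_def by blast

lemma geodesic_segment_ends:
  assumes "Metric_space X d" "geodesic_segment X d x y S"
  shows "x \<in> S" "y \<in> S" "S \<subseteq> X" 
    "\<And>p. p \<in> S \<Longrightarrow> d x p + d p y = d x y"
proof -
  interpret Metric_space X d by fact
  obtain \<gamma> where \<gamma>: "\<gamma> \<in> {0..d x y} \<rightarrow> X" "\<gamma> 0 = x" "\<gamma> (d x y) = y"
      "\<And>s t. s\<in>{0..d x y} \<Longrightarrow> t\<in>{0..d x y} \<Longrightarrow> d (\<gamma> s) (\<gamma> t) = \<bar>s - t\<bar>"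
      "S = \<gamma> ` {0..d x y}"
    using assms(2) unfolding geodesic_segment_def by blast
  have m: "0 \<in> {0..d x y}" "d x y \<in> {0..d x y}" by auto
  show "x \<in> S" using imageI[OF m(1), of \<gamma>] by (simp only: \<gamma>(2) \<gamma>(5))
  show "y \<in> S" using imageI[OF m(2), of \<gamma>] by (simp only: \<gamma>(3) \<gamma>(5))
  show "S \<subseteq> X" unfolding \<gamma>(5) using \<gamma>(1) by blast
  fix p assume "p \<in> S"
  then obtain t where "t \<in> {0..d x y}" "p = \<gamma> t" using \<gamma>(5) by blast
  then show "d x p + d p y = d x y" using \<gamma>(4)[OF m(1), of t] \<gamma>(4)[of t "d x y", OF _ m(2)] \<gamma>(2,3) by simp
qed

text \<open>A point that almost realises the triangle inequality for \<open>x\<close>, \<open>y\<close> lies close to the point of the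
segment at the same distance from \<open>x\<close>: the four-point inequality compares the two.\<close>

lemma near_geodesic_if_four_point:
  assumes M: "Metric_space X d" and fp: "four_point X d C" and C: "C \<ge> 0"
    and x: "x \<in> X" and y: "y \<in> X" and p: "p \<in> X" and P: "geodesic_segment X d x y P"
    and excess: "d p x + d p y \<le> d x y + E" and E: "E \<ge> 0"
  shows "\<exists>q\<in>P. d p q \<le> E + C"
proof -
  interpret Metric_space X d by fact
  obtain \<gamma> where \<gamma>: "\<gamma> \<in> {0..d x y} \<rightarrow> X" "\<gamma> 0 = x" "\<gamma> (d x y) = y"
      "\<And>s t. s\<in>{0..d x y} \<Longrightarrow> t\<in>{0..d x y} \<Longrightarrow> d (\<gamma> s) (\<gamma> t) = \<bar>s - t\<bar>"
      "P = \<gamma> ` {0..d x y}"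
    using P unfolding geodesic_segment_def by blast
  have sym: "d p x = d x p" "d p y = d y p" by (simp_all add: commute)
  show ?thesis
  proof (cases "d x p \<le> d x y")
    case True
    define q where "q = \<gamma> (d x p)"
    have "d x p \<in> {0..d x y}" using True by simp
    then have q: "q \<in> P" unfolding q_def \<gamma>(5) by (rule imageI)
    then have qX: "q \<in> X" using geodesic_segment_ends(3)[OF M P] by blast
    have "d x q = d x p" using \<gamma>(4)[of 0 "d x p"] True \<gamma>(2) by (simp add: q_def)
    moreover have "d y q = d x y - d x p"
      using \<gamma>(4)[of "d x y" "d x p"] True \<gamma>(3) by (simp add: q_def)
    moreover have "d x y + d p q \<le> max (d x p + d y q) (d x q + d y p) + C"
      using four_pointD[OF fp x y p qX] .
    ultimately have "d p q \<le> E + C" using excess sym E by simp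
    with q show ?thesis by blast
  next
    case False
    have "y \<in> P" using geodesic_segment_ends(2)[OF M P] .
    moreover have "d p y \<le> E + C" using False excess sym C by simp
    ultimately show ?thesis by blast
  qed
qed

text \<open>For \<open>p\<close> on the side between \<open>x\<close> and \<open>z\<close>, the four-point inequality for \<open>x\<close>, \<open>z\<close>, \<open>y\<close>, \<open>p\<close> says that \<open>p\<close> almost
realises the triangle inequality for one of the pairs \<open>x\<close>, \<open>y\<close> and \<open>y\<close>, \<open>z\<close>.\<close>

lemma hyperbolic_space_if_four_point:
  assumes geo: "geodesic_space X d" and fp: "four_point X d C" and C: "C \<ge> 0"
  shows "hyperbolic_space X d"
proof -
  have M: "Metric_space X d" using geo by (simp add: geodesic_space_def)
  interpret Metric_space X d by fact
  have *: "\<exists>q\<in>P \<union> Q. d p q \<le> 2 * C"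
    if x: "x \<in> X" and y: "y \<in> X" and z: "z \<in> X"
      and P: "geodesic_segment X d x y P" and Q: "geodesic_segment X d y z Q"
      and S: "geodesic_segment X d x z S" and p: "p \<in> S" for x y z P Q S p
  proof -
    have pX: "p \<in> X" using geodesic_segment_ends(3)[OF M S] p by blast
    have eq: "d p x + d p z = d x z"
      using geodesic_segment_ends(4)[OF M S p] by (simp add: commute)
    have "d x z + d y p \<le> max (d x y + d z p) (d x p + d z y) + C"
      using four_pointD[OF fp x z y pX] .
    then have "d p x + d p y \<le> d x y + C \<or> d p y + d p z \<le> d y z + C"
      using eq by (auto simp: commute max_def split: if_splits)
    then show ?thesis
    proof
      assume "d p x + d p y \<le> d x y + C"
      from near_geodesic_if_four_point[OF M fp C x y pX P this C] show ?thesis by auto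
    next
      assume "d p y + d p z \<le> d y z + C"
      from near_geodesic_if_four_point[OF M fp C y z pX Q this C] show ?thesis by auto
    qed
  qed
  show ?thesis unfolding hyperbolic_space_def
  proof (intro conjI exI[of _ "2 * C"] ballI allI impI geo)
    show "0 \<le> 2 * C" using C by simp
  qed (rule *)
qed

text \<open>Connectedness of a geodesic side: it is covered by the neighbourhoods of the two other sides, its
first end lies in one of them and its last end in the other, so the two neighbourhoods almost meet.\<close>

lemma side_point_near_both_other_sides:
  assumes M: "Metric_space X d" and x: "x \<in> X" and y: "y \<in> X"
    and \<delta>: "\<delta> \<ge> 0"
    and S: "geodesic_segment X d x y S"
    and P: "x \<in> P" "P \<subseteq> X" and Q: "y \<in> Q" "Q \<subseteq> X"
    and slim: "\<And>p. p \<in> S \<Longrightarrow> \<exists>q\<in>P \<union> Q. d p q \<le> \<delta>"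
  shows "\<exists>p\<in>S. (\<exists>q\<in>P. d p q \<le> \<delta> + 2) \<and> (\<exists>q\<in>Q. d p q \<le> \<delta> + 2)"
proof -
  interpret Metric_space X d by fact
  define D where "D = d x y"
  have D: "D \<ge> 0" by (simp add: D_def)
  obtain \<gamma> where \<gamma>: "\<gamma> \<in> {0..D} \<rightarrow> X" "\<gamma> 0 = x" "\<gamma> D = y"
      "\<And>s t. s\<in>{0..D} \<Longrightarrow> t\<in>{0..D} \<Longrightarrow> d (\<gamma> s) (\<gamma> t) = \<bar>s - t\<bar>"
      "S = \<gamma> ` {0..D}"
    using S unfolding geodesic_segment_def D_def by blast
  define T where "T = {t\<in>{0..D}. \<exists>q\<in>P. d (\<gamma> t) q \<le> \<delta>}"
  have T0: "0 \<in> T" using \<gamma>(2) P x \<delta> D by (auto simp: T_def intro!: bexI[of _ x])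
  have bdd: "bdd_above T" by (rule bdd_aboveI[of _ D]) (auto simp: T_def)
  define \<sigma> where "\<sigma> = Sup T"
  have \<sigma>0: "\<sigma> \<ge> 0" using cSup_upper[OF T0 bdd] by (simp add: \<sigma>_def)
  have \<sigma>D: "\<sigma> \<le> D" unfolding \<sigma>_def using T0 by (intro cSup_least) (auto simp: T_def)
  obtain t where t: "t \<in> T" "\<sigma> - 1 < t"
    using less_cSup_iff[OF _ bdd, of "\<sigma> - 1"] T0 by (auto simp: \<sigma>_def)
  have tle: "t \<le> \<sigma>" using cSup_upper[OF t(1) bdd] by (simp add: \<sigma>_def)
  \<comment> \<open>\<open>t\<close> lies at most 1 below the supremum \<open>\<sigma>\<close> and \<open>s\<close> at most 1 above it, which accounts for the 2 in the bound.\<close>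
  define s where "s = min D (\<sigma> + 1)"
  have s: "s \<in> {0..D}" using \<sigma>0 D by (auto simp: s_def)
  have "\<exists>q\<in>Q. d (\<gamma> s) q \<le> \<delta>"
  proof (cases "s = D")
    case True
    then show ?thesis using \<gamma>(3) Q y \<delta> by (auto intro!: bexI[of _ y])
  next
    case False
    then have "s = \<sigma> + 1" by (auto simp: s_def min_def split: if_splits)
    then have "s \<notin> T" using cSup_upper[OF _ bdd, of s] by (auto simp: \<sigma>_def)
    then show ?thesis using slim[of "\<gamma> s"] s \<gamma>(5) by (auto simp: T_def)
  qed
  then obtain q where q: "q \<in> Q" "d (\<gamma> s) q \<le> \<delta>" by blast
  have tD: "t \<in> {0..D}" using t by (auto simp: T_def)
  have "d (\<gamma> t) (\<gamma> s) \<le> 2"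
    using \<gamma>(4)[OF tD s] tle t(2) \<sigma>D by (auto simp: s_def min_def abs_if split: if_splits)
  moreover have "d (\<gamma> t) q \<le> d (\<gamma> t) (\<gamma> s) + d (\<gamma> s) q"
    using \<gamma>(1) tD s q Q(2) by (intro triangle) auto
  ultimately have "d (\<gamma> t) q \<le> \<delta> + 2" using q by argo
  moreover have "\<exists>q\<in>P. d (\<gamma> t) q \<le> \<delta> + 2" using t by (force simp: T_def)
  moreover have "\<gamma> t \<in> S" using tD \<gamma>(5) by blast
  ultimately show ?thesis using q(1) by blast
qed

text \<open>A point \<open>p\<close> of the segment between \<open>x\<close> and \<open>y\<close> that is close to both other sides of the triangle with
apex \<open>w\<close> has distance to \<open>w\<close> close to the Gromov product of \<open>x\<close> and \<open>y\<close> at \<open>w\<close>. It is also close to a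
side of the triangle with apex \<open>z\<close>, which bounds the Gromov product of \<open>z\<close> with \<open>x\<close> or with \<open>y\<close>.\<close>

lemma four_point_if_hyperbolic_space:
  assumes hyp: "hyperbolic_space X d"
  shows "\<exists>C\<ge>0. four_point X d C"
proof -
  have M: "Metric_space X d" and geo: "\<And>x y. x \<in> X \<Longrightarrow> y \<in> X \<Longrightarrow> \<exists>S. geodesic_segment X d x y S"
    using hyp by (auto simp: hyperbolic_space_def geodesic_space_def)
  interpret Metric_space X d by fact
  obtain \<delta> where \<delta>: "\<delta> \<ge> 0" and slim: "\<And>x y z P Q S p. x\<in>X \<Longrightarrow> y\<in>X \<Longrightarrow> z\<in>X \<Longrightarrow>
        geodesic_segment X d x y P \<Longrightarrow> geodesic_segment X d y z Q \<Longrightarrow> geodesic_segment X d x z S \<Longrightarrow>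
        p\<in>S \<Longrightarrow> \<exists>q\<in>P \<union> Q. d p q \<le> \<delta>"
    using hyp unfolding hyperbolic_space_def by blast
  have rev: "geodesic_segment X d y x S" if S: "geodesic_segment X d x y S" for x y S
  proof -
    obtain \<gamma> where \<gamma>: "\<gamma> \<in> {0..d x y} \<rightarrow> X" "\<gamma> 0 = x" "\<gamma> (d x y) = y"
      "\<And>s t. s\<in>{0..d x y} \<Longrightarrow> t\<in>{0..d x y} \<Longrightarrow> d (\<gamma> s) (\<gamma> t) = \<bar>s - t\<bar>"
      "S = \<gamma> ` {0..d x y}"
      using S unfolding geodesic_segment_def by blast
    have c: "d y x = d x y" by (simp add: commute)
    have im: "S = (\<lambda>t. \<gamma> (d x y - t)) ` {0..d x y}"
    proof -
      have "{0..d x y} = (\<lambda>t. d x y - t) ` {0..d x y}" by simp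
      then show ?thesis using \<gamma>(5) by (metis image_image)
    qed
    show ?thesis unfolding geodesic_segment_def c
      by (rule exI[of _ "\<lambda>t. \<gamma> (d x y - t)"]) (use \<gamma> im in \<open>auto simp: Pi_iff\<close>)
  qed
  have "d x y + d z w \<le> max (d x z + d y w) (d x w + d y z) + (6 * \<delta> + 8)"
    if x: "x \<in> X" and y: "y \<in> X" and z: "z \<in> X" and w: "w \<in> X" for x y z w
  proof -
    obtain S P Q U V where S: "geodesic_segment X d x y S" and P: "geodesic_segment X d x w P"
      and Q: "geodesic_segment X d w y Q" and U: "geodesic_segment X d x z U"
      and V: "geodesic_segment X d z y V" using geo x y z w by metis
    have "\<exists>p\<in>S. (\<exists>q\<in>P. d p q \<le> \<delta> + 2) \<and> (\<exists>q\<in>Q. d p q \<le> \<delta> + 2)"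
      using side_point_near_both_other_sides[OF M x y \<delta> S, of P Q] slim[OF x w y P Q S]
        geodesic_segment_ends[OF M P] geodesic_segment_ends[OF M Q] by blast
    then obtain p q q' where p: "p \<in> S" and q: "q \<in> P" "d p q \<le> \<delta> + 2"
      and q': "q' \<in> Q" "d p q' \<le> \<delta> + 2" by blast
    obtain r where r: "r \<in> U \<union> V" "d p r \<le> \<delta>" using slim[OF x z y U V S p] by blast
    have X: "p \<in> X" "q \<in> X" "q' \<in> X" "r \<in> X"
      using p q q' r geodesic_segment_ends(3)[OF M] S P Q U V by blast+
    note eqs = geodesic_segment_ends(4)[OF M S p] geodesic_segment_ends(4)[OF M P q(1)]
      geodesic_segment_ends(4)[OF M Q q'(1)]
    have tri: "d w p \<le> d w q + d q p" "d p x \<le> d p q + d q x" "d w p \<le> d w q' + d q' p"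
      "d p y \<le> d p q' + d q' y" "d z w \<le> d z r + d r w" "d r w \<le> d r p + d p w" 
      using X x y z w by (auto intro: triangle)
    have sy: "d q p = d p q" "d x q = d q x" "d x p = d p x" "d q w = d w q" "d q' p = d p q'"
      "d r p = d p r" "d p w = d w p" "d x w = d w x" "d y w = d w y" "d z r = d r z"
      by (simp_all add: commute)
    have "d w p + d x p \<le> d x w + 2 * (\<delta> + 2)"
      using tri(1,2) eqs(2) q(2) sy(1-4) by argo
    moreover have "d w p + d p y \<le> d w y + 2 * (\<delta> + 2)"
      using tri(3,4) eqs(3) q'(2) sy(5) by argo
    ultimately have wp: "2 * d w p \<le> d x w + d y w - d x y + 4 * (\<delta> + 2)"
      using eqs(1) sy(9) by argo
    have rw: "d r w \<le> \<delta> + d w p" using tri(6) sy(6,7) r(2) by argo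
    from r(1) show ?thesis
    proof
      assume "r \<in> U"
      then have "d x z = d x r + d z r" using geodesic_segment_ends(4)[OF M U] sy(10) by simp
      moreover have "d x w \<le> d x r + d r w" using X x w by (auto intro: triangle)
      ultimately have "d x y + d z w \<le> d x z + d y w + (6 * \<delta> + 8)"
        using wp rw tri(5) by argo
      then show ?thesis by argo
    next
      assume "r \<in> V"
      then have "d y z = d y r + d z r"
        using geodesic_segment_ends(4)[OF M V, of r] by (simp add: commute)
      moreover have "d y w \<le> d y r + d r w" using X y w by (auto intro: triangle)
      ultimately have "d x y + d z w \<le> d x w + d y z + (6 * \<delta> + 8)"
        using wp rw tri(5) by argo
      then show ?thesis by argo
    qed
  qed
  then show ?thesis using \<delta> unfolding four_point_def by (intro exI[of _ "6 * \<delta> + 8"]) auto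
qed

section \<open>The upper half-plane as a hyperbolic space\<close>

definition uhp :: "complex set" where
  "uhp = {z. Im z > 0}"

text \<open>The Poincare distance. The absolute values only keep the function nonnegative outside the upper
half-plane, as the axioms of a metric space require it on the whole type.\<close>

definition hdist :: "complex \<Rightarrow> complex \<Rightarrow> real" where
  "hdist z w = 2 * arsinh (cmod (z - w) / (2 * sqrt (\<bar>Im z\<bar> * \<bar>Im w\<bar>)))"

lemma sinh_hdist:
  assumes "z \<in> uhp" "w \<in> uhp"
  shows "sinh (hdist z w / 2) = cmod (z - w) / (2 * sqrt (Im z * Im w))"
  using assms by (simp add: hdist_def uhp_def)

text \<open>Together with \<open>sinh_hdist\<close> this turns statements about distances into identities for products
of differences of the points and their conjugates.\<close>

lemma cosh_hdist:
  assumes "z \<in> uhp" "w \<in> uhp"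
  shows "cosh (hdist z w / 2) = cmod (z - cnj w) / (2 * sqrt (Im z * Im w))"
proof (rule power2_eq_imp_eq)
  have pos: "Im z > 0" "Im w > 0" using assms by (auto simp: uhp_def)
  have "(cosh (hdist z w / 2))\<^sup>2 = (cmod (z - w))\<^sup>2 / (4 * (Im z * Im w)) + 1"
    using pos by (simp add: cosh_square_eq sinh_hdist[OF assms] power_divide power_mult_distrib)
  also have "(cmod (z - w))\<^sup>2 = (cmod (z - cnj w))\<^sup>2 - 4 * (Im z * Im w)"
    unfolding cmod_power2 by (simp add: power2_eq_square algebra_simps)
  finally show "(cosh (hdist z w / 2))\<^sup>2 = (cmod (z - cnj w) / (2 * sqrt (Im z * Im w)))\<^sup>2"
    using pos by (simp add: power_divide power_mult_distrib diff_divide_distrib)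
  show "0 \<le> cmod (z - cnj w) / (2 * sqrt (Im z * Im w))" using pos by simp
qed simp

lemma hdist_commute: "hdist z w = hdist w z"
  by (simp add: hdist_def norm_minus_commute mult.commute)

lemma hdist_nonneg: "hdist z w \<ge> 0"
proof -
  have "sinh 0 \<le> sinh (hdist z w / 2)" by (simp add: hdist_def)
  then show ?thesis unfolding sinh_real_le_iff by simp
qed

lemma hdist_eq_0_iff:
  assumes "z \<in> uhp" "w \<in> uhp" shows "hdist z w = 0 \<longleftrightarrow> z = w"
proof -
  have "hdist z w = 0 \<longleftrightarrow> sinh (hdist z w / 2) = 0" by simp
  then show ?thesis using assms by (simp add: sinh_hdist[OF assms] uhp_def)
qed

lemma cmod_diff_cnj_commute: "cmod (z - cnj w) = cmod (w - cnj z)"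
proof -
  have "cmod (z - cnj w) = cmod (cnj (z - cnj w))" by (rule complex_mod_cnj[symmetric])
  also have "\<dots> = cmod (w - cnj z)" by (simp add: norm_minus_commute)
  finally show ?thesis .
qed

text \<open>Ptolemy's inequality for \<open>a\<close>, \<open>c\<close>, \<open>b\<close> and the conjugate of \<open>b\<close>: after division by the imaginary parts
its right-hand side is the addition formula of \<open>sinh\<close>.\<close>

lemma hdist_triangle:
  assumes a: "a \<in> uhp" and b: "b \<in> uhp" and c: "c \<in> uhp"
  shows "hdist a c \<le> hdist a b + hdist b c"
proof -
  have pos: "Im a > 0" "Im b > 0" "Im c > 0" using assms by (auto simp: uhp_def)
  define sa sb sc where s: "sa = sqrt (Im a)" "sb = sqrt (Im b)" "sc = sqrt (Im c)"
  have s0: "sa > 0" "sb > 0" "sc > 0" and sb2: "sb * sb = Im b" using pos by (auto simp: s)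
  have "(a - c) * (b - cnj b) = (a - b) * (c - cnj b) + (a - cnj b) * (b - c)"
    by (simp add: algebra_simps)
  then have "cmod (a - c) * cmod (b - cnj b) \<le> cmod (a - b) * cmod (c - cnj b) + cmod (a - cnj b) * cmod (b - c)"
    by (metis norm_mult norm_triangle_ineq)
  moreover have "cmod (b - cnj b) = 2 * (sb * sb)"
    using pos by (simp add: sb2 complex_diff_cnj norm_mult)
  ultimately have main: "cmod (a - c) * (2 * (sb * sb)) \<le> cmod (a - b) * cmod (b - cnj c) + cmod (a - cnj b) * cmod (b - c)"
    by (simp add: cmod_diff_cnj_commute[of c b])
  have "sinh (hdist a c / 2) = cmod (a - c) * (2 * (sb * sb)) / (4 * (sa * sb) * (sb * sc))"
    unfolding sinh_hdist[OF a c] real_sqrt_mult s[symmetric] using s0 by simp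
  also have "\<dots> \<le> (cmod (a - b) * cmod (b - cnj c) + cmod (a - cnj b) * cmod (b - c)) / (4 * (sa * sb) * (sb * sc))"
    using main s0 by (intro divide_right_mono) auto
  also have "\<dots> = sinh (hdist a b / 2 + hdist b c / 2)"
    unfolding sinh_add sinh_hdist[OF a b] sinh_hdist[OF b c] cosh_hdist[OF a b] cosh_hdist[OF b c] real_sqrt_mult s[symmetric]
    using s0 by (simp add: field_simps)
  finally show ?thesis by simp
qed

text \<open>Up to a factor between 1/2 and 1, \<open>cosh\<close> is the exponential function on nonnegative numbers.\<close>

lemma sum_le_max_if_cosh_le:
  assumes "p \<ge> 0" "q \<ge> 0" "r \<ge> 0" "s \<ge> 0" "t \<ge> 0" "u \<ge> (0::real)"
    and le: "cosh p * cosh q \<le> cosh r * cosh s + cosh t * cosh u"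
  shows "p + q \<le> max (r + s) (t + u) + ln 8"
proof -
  have lower: "exp x / 2 \<le> cosh x" for x :: real by (simp add: cosh_def)
  have upper: "cosh x \<le> exp x" if "x \<ge> 0" for x :: real using that by (simp add: cosh_def)
  define m where "m = max (r + s) (t + u)"
  have "exp (p + q) / 4 = (exp p / 2) * (exp q / 2)" by (simp add: exp_add)
  also have "\<dots> \<le> cosh p * cosh q" by (intro mult_mono lower) auto
  also have "\<dots> \<le> exp r * exp s + exp t * exp u"
    using assms by (intro order.trans[OF le] add_mono mult_mono upper) auto
  also have "\<dots> = exp (r + s) + exp (t + u)" by (simp add: exp_add)
  also have "\<dots> \<le> exp m + exp m" by (intro add_mono) (auto simp: m_def)
  finally have "exp (p + q) \<le> 8 * exp m" by simp
  also have "\<dots> = exp (m + ln 8)" by (simp add: exp_add)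
  finally show ?thesis by (simp add: m_def)
qed

text \<open>Ptolemy's inequality for \<open>a\<close>, \<open>c\<close> and the conjugates of \<open>b\<close>, \<open>e\<close> bounds one product of hyperbolic cosines
by the sum of the two others.\<close>

lemma four_point_uhp: "four_point uhp hdist (2 * ln 8)"
  unfolding four_point_def
proof (intro ballI)
  fix a b c e assume a: "a \<in> uhp" and b: "b \<in> uhp" and c: "c \<in> uhp" and e: "e \<in> uhp"
  have pos: "Im a > 0" "Im b > 0" "Im c > 0" "Im e > 0" using a b c e by (auto simp: uhp_def)
  define sa sb sc se where s: "sa = sqrt (Im a)" "sb = sqrt (Im b)" "sc = sqrt (Im c)" "se = sqrt (Im e)"
  have s0: "sa > 0" "sb > 0" "sc > 0" "se > 0" using pos by (auto simp: s)
  have "(a - cnj b) * (c - cnj e) = (a - cnj e) * (c - cnj b) + (a - c) * (cnj b - cnj e)"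
    by (simp add: algebra_simps)
  then have "cmod (a - cnj b) * cmod (c - cnj e) \<le> cmod (a - cnj e) * cmod (c - cnj b) + cmod (a - c) * cmod (cnj b - cnj e)"
    by (metis norm_mult norm_triangle_ineq)
  also have "cmod (cnj b - cnj e) = cmod (b - e)"
    by (metis complex_cnj_diff complex_mod_cnj)
  also have "cmod (c - cnj b) = cmod (b - cnj c)" by (rule cmod_diff_cnj_commute)
  finally have main: "cmod (a - cnj b) * cmod (c - cnj e) \<le> cmod (a - cnj e) * cmod (b - cnj c) + cmod (a - c) * cmod (b - e)" .
  have "cosh (hdist a b / 2) * cosh (hdist c e / 2)
      = (cmod (a - cnj b) * cmod (c - cnj e)) / (4 * (sa * sb) * (sc * se))"
    unfolding cosh_hdist[OF a b] cosh_hdist[OF c e] real_sqrt_mult s[symmetric] by simp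
  also have "\<dots> \<le> (cmod (a - cnj e) * cmod (b - cnj c) + cmod (a - c) * cmod (b - e)) / (4 * (sa * sb) * (sc * se))"
    using main s0 by (intro divide_right_mono) auto
  also have "\<dots> = cosh (hdist a e / 2) * cosh (hdist b c / 2) + sinh (hdist a c / 2) * sinh (hdist b e / 2)"
    unfolding sinh_hdist[OF a c] sinh_hdist[OF b e] cosh_hdist[OF a e] cosh_hdist[OF b c] real_sqrt_mult s[symmetric]
    using s0 by (simp add: field_simps)
  also have "\<dots> \<le> cosh (hdist a e / 2) * cosh (hdist b c / 2) + cosh (hdist a c / 2) * cosh (hdist b e / 2)"
    by (intro add_left_mono mult_mono) (auto intro: sinh_le_cosh_real hdist_nonneg)
  finally have "hdist a b / 2 + hdist c e / 2 \<le> max (hdist a e / 2 + hdist b c / 2) (hdist a c / 2 + hdist b e / 2) + ln 8"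
    by (intro sum_le_max_if_cosh_le) (auto intro: hdist_nonneg)
  then show "hdist a b + hdist c e \<le> max (hdist a c + hdist b e) (hdist a e + hdist b c) + 2 * ln 8"
    by (auto simp: max_def split: if_splits)
qed

lemma hdist_eqI:
  assumes "z \<in> uhp" "w \<in> uhp"
    and eq: "(cmod (z - w))\<^sup>2 = 2 * (Im z * Im w) * (cosh u - 1)"
  shows "hdist z w = \<bar>u\<bar>"
proof -
  have pos: "Im z * Im w > 0" using assms by (auto simp: uhp_def)
  have ch: "cosh u - 1 = 2 * (sinh (u / 2))\<^sup>2"
    using cosh_double[of "u / 2"] by (simp add: cosh_square_eq)
  have "(cmod (z - w))\<^sup>2 = (2 * sqrt (Im z * Im w) * \<bar>sinh (u / 2)\<bar>)\<^sup>2"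
    unfolding eq ch power_mult_distrib using pos by simp
  then have "cmod (z - w) = 2 * sqrt (Im z * Im w) * \<bar>sinh (u / 2)\<bar>"
    by (rule power2_eq_imp_eq) (use pos in simp_all)
  then have "sinh (hdist z w / 2) = \<bar>sinh (u / 2)\<bar>"
    unfolding sinh_hdist[OF assms(1,2)] using assms(1,2) by (auto simp: uhp_def)
  also have "\<dots> = sinh (\<bar>u\<bar> / 2)" using sinh_real_abs[of "u / 2"] by simp
  finally show ?thesis by simp
qed

text \<open>Geodesics are vertical rays and semicircles with centre on the real axis, the latter
parametrised by \<open>tanh\<close> and \<open>1 / cosh\<close>.\<close>

lemma geodesic_line_through:
  assumes z: "z \<in> uhp" and w: "w \<in> uhp"
  obtains \<gamma> :: "real \<Rightarrow> complex" and s0 t0 where "\<And>t. \<gamma> t \<in> uhp" "\<gamma> s0 = z" "\<gamma> t0 = w"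
    "\<And>s t. hdist (\<gamma> s) (\<gamma> t) = \<bar>s - t\<bar>"
proof (cases "Re z = Re w")
  case True
  define \<gamma> where "\<gamma> t = Complex (Re z) (exp t)" for t
  show thesis
  proof (rule that)
    show in_uhp: "\<gamma> t \<in> uhp" for t by (simp add: \<gamma>_def uhp_def)
    show "\<gamma> (ln (Im z)) = z" "\<gamma> (ln (Im w)) = w"
      using z w True by (auto simp: \<gamma>_def uhp_def complex_eq_iff)
    have "(exp s - exp t)\<^sup>2 = 2 * (exp s * exp t) * (cosh (s - t) - 1)" for s t :: real
      by (simp add: cosh_def exp_diff exp_minus power2_eq_square field_simps)
    then show "hdist (\<gamma> s) (\<gamma> t) = \<bar>s - t\<bar>" for s t
      by (intro hdist_eqI in_uhp) (simp add: \<gamma>_def cmod_power2)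
  qed
next
  case False
  define N D where ND: "N = (Re w)\<^sup>2 + (Im w)\<^sup>2 - (Re z)\<^sup>2 - (Im z)\<^sup>2" "D = 2 * (Re w - Re z)"
  define c where "c = N / D"
  have "D \<noteq> 0" using False by (simp add: ND)
  then have cD: "c * D = N" by (simp add: c_def)
  define r where "r = sqrt ((Re z - c)\<^sup>2 + (Im z)\<^sup>2)"
  have Im: "Im z > 0" "Im w > 0" using z w by (auto simp: uhp_def)
  have r: "r > 0" using Im by (simp add: r_def add_nonneg_pos)
  have rz: "r\<^sup>2 = (Re z - c)\<^sup>2 + (Im z)\<^sup>2" by (simp add: r_def)
  have rw: "r\<^sup>2 = (Re w - c)\<^sup>2 + (Im w)\<^sup>2"
    using cD unfolding rz ND by (simp add: power2_eq_square algebra_simps)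
  define \<gamma> where "\<gamma> t = Complex (c + r * tanh t) (r / cosh t)" for t
  have hit: "\<gamma> (arsinh ((Re p - c) / Im p)) = p" if "Im p > 0" "r\<^sup>2 = (Re p - c)\<^sup>2 + (Im p)\<^sup>2" for p
  proof -
    define t where "t = arsinh ((Re p - c) / Im p)"
    have sh: "sinh t = (Re p - c) / Im p" by (simp add: t_def)
    have "(cosh t)\<^sup>2 = (r / Im p)\<^sup>2"
      using that(1) unfolding cosh_square_eq sh power_divide that(2) by (simp add: add_divide_distrib)
    then have ch: "cosh t = r / Im p" by (rule power2_eq_imp_eq) (use r that(1) in simp_all)
    show ?thesis unfolding t_def[symmetric] \<gamma>_def
      using r that(1) by (simp add: complex_eq_iff tanh_def sh ch)
  qed
  show thesis
  proof (rule that)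
    show in_uhp: "\<gamma> t \<in> uhp" for t using r by (simp add: \<gamma>_def uhp_def)
    show "\<gamma> (arsinh ((Re z - c) / Im z)) = z" "\<gamma> (arsinh ((Re w - c) / Im w)) = w"
      using hit Im rz rw by auto
    have "(r * tanh s - r * tanh t)\<^sup>2 + (r / cosh s - r / cosh t)\<^sup>2
        = 2 * (r / cosh s * (r / cosh t)) * (cosh (s - t) - 1)" for s t
    proof -
      define cs ct ss st where d: "cs = cosh s" "ct = cosh t" "ss = sinh s" "st = sinh t"
      have p: "cs > 0" "ct > 0" by (auto simp: d)
      have sq: "ss\<^sup>2 = cs\<^sup>2 - 1" "st\<^sup>2 = ct\<^sup>2 - 1" by (auto simp: d sinh_square_eq)
      have "(ss * ct - st * cs)\<^sup>2 + (ct - cs)\<^sup>2 = ss\<^sup>2 * ct\<^sup>2 + st\<^sup>2 * cs\<^sup>2 - 2 * (ss * st * cs * ct) + (ct - cs)\<^sup>2"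
        by (simp add: power2_eq_square algebra_simps)
      also have "\<dots> = 2 * (cs * ct) * (cs * ct - ss * st - 1)"
        unfolding sq by (simp add: power2_eq_square algebra_simps)
      finally have e: "(ss * ct - st * cs)\<^sup>2 + (ct - cs)\<^sup>2 = 2 * (cs * ct) * (cs * ct - ss * st - 1)" .
      have "(r * (ss / cs) - r * (st / ct))\<^sup>2 + (r / cs - r / ct)\<^sup>2
          = r\<^sup>2 / (cs * ct)\<^sup>2 * ((ss * ct - st * cs)\<^sup>2 + (ct - cs)\<^sup>2)"
      proof -
        have "r * (ss / cs) - r * (st / ct) = r / (cs * ct) * (ss * ct - st * cs)"
          "r / cs - r / ct = r / (cs * ct) * (ct - cs)"
          using p by (simp_all add: field_simps)
        then show ?thesis by (simp only: power_mult_distrib power_divide distrib_left)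
      qed
      also have "\<dots> = 2 * (r / cs * (r / ct)) * (cs * ct - ss * st - 1)"
        unfolding e using p by (simp add: power2_eq_square)
      finally show ?thesis by (simp add: tanh_def cosh_diff d)
    qed
    then have "(cmod (\<gamma> s - \<gamma> t))\<^sup>2 = 2 * (Im (\<gamma> s) * Im (\<gamma> t)) * (cosh (s - t) - 1)" for s t
      unfolding cmod_power2 \<gamma>_def by simp
    then show "hdist (\<gamma> s) (\<gamma> t) = \<bar>s - t\<bar>" for s t
      by (intro hdist_eqI in_uhp)
  qed
qed

text \<open>The copy under an injection is needed because the points of the spaces in property (NL) belong to
a prescribed type.\<close>

lemma hyperbolic_space_copy_uhp:
  assumes j: "inj_on j uhp"
  defines "k \<equiv> inv_into uhp j"
  shows "hyperbolic_space (j ` uhp) (\<lambda>x y. hdist (k x) (k y))"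
proof -
  define X where "X = j ` uhp"
  define d where "d x y = hdist (k x) (k y)" for x y
  have kj: "k (j z) = z" if "z \<in> uhp" for z using that j by (simp add: k_def)
  have kX: "k x \<in> uhp" "j (k x) = x" if "x \<in> X" for x
    using that by (auto simp: X_def kj)
  have M: "Metric_space X d"
  proof
    show "0 \<le> d x y" for x y unfolding d_def by (rule hdist_nonneg)
    show "d x y = d y x" for x y unfolding d_def by (rule hdist_commute)
    show "d x y = 0 \<longleftrightarrow> x = y" if "x \<in> X" "y \<in> X" for x y
      unfolding d_def hdist_eq_0_iff[OF kX(1)[OF that(1)] kX(1)[OF that(2)]]
      using kX(2)[OF that(1)] kX(2)[OF that(2)] by metis
    show "d x z \<le> d x y + d y z" if "x \<in> X" "y \<in> X" "z \<in> X" for x y z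
      unfolding d_def using that by (intro hdist_triangle kX(1))
  qed
  have "\<exists>S. geodesic_segment X d x y S" if x: "x \<in> X" and y: "y \<in> X" for x y
  proof -
    obtain \<gamma> s0 t0 where \<gamma>: "\<And>t. \<gamma> t \<in> uhp" "\<gamma> s0 = k x" "\<gamma> t0 = k y"
      "\<And>s t. hdist (\<gamma> s) (\<gamma> t) = \<bar>s - t\<bar>"
      using geodesic_line_through[OF kX(1)[OF x] kX(1)[OF y]] by blast
    have dxy: "d x y = \<bar>s0 - t0\<bar>" by (simp add: d_def \<gamma>(4) flip: \<gamma>(2,3))
    define e :: real where "e = (if s0 \<le> t0 then 1 else - 1)"
    have e: "\<bar>e\<bar> = 1" "s0 + e * \<bar>s0 - t0\<bar> = t0" by (auto simp: e_def)
    have ab: "\<bar>e * s - e * t\<bar> = \<bar>s - t\<bar>" for s t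
      by (metis abs_mult e(1) mult.left_neutral right_diff_distrib)
    define \<eta> where "\<eta> t = j (\<gamma> (s0 + e * t))" for t
    have "\<eta> t \<in> X" for t using \<gamma>(1) by (simp add: \<eta>_def X_def)
    moreover have "\<eta> 0 = x" using kX(2)[OF x] by (simp add: \<eta>_def \<gamma>(2))
    moreover have "\<eta> (d x y) = y" using kX(2)[OF y] by (simp add: \<eta>_def \<gamma>(3) dxy e(2))
    moreover have "d (\<eta> s) (\<eta> t) = \<bar>s - t\<bar>" for s t
      by (simp add: \<eta>_def d_def kj[OF \<gamma>(1)] \<gamma>(4) ab)
    ultimately show ?thesis unfolding geodesic_segment_def
      by (intro exI[of _ "\<eta> ` {0..d x y}"] exI[of _ \<eta>]) simp
  qed
  then have "geodesic_space X d" using M by (simp add: geodesic_space_def)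
  moreover have "four_point X d (2 * ln 8)"
    using four_pointD[OF four_point_uhp] kX(1) unfolding four_point_def d_def by simp
  ultimately have "hyperbolic_space X d" by (rule hyperbolic_space_if_four_point) simp
  then show ?thesis by (simp add: X_def d_def[abs_def])
qed

section \<open>Fractional linear maps of the upper half-plane\<close>

text \<open>Real fractional linear maps act on the nonreal numbers and commute with conjugation. Working modulo
conjugation makes matrices of negative determinant, in particular reflections, act on the upper
half-plane without a separate formula.\<close>

definition to_uhp :: "complex \<Rightarrow> complex" where
  "to_uhp w = (if Im w > 0 then w else cnj w)"

definition frac_lin :: "real \<Rightarrow> real \<Rightarrow> real \<Rightarrow> real \<Rightarrow> complex \<Rightarrow> complex" where
  "frac_lin a b c d z = (of_real a * z + of_real b) / (of_real c * z + of_real d)"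

definition moebius :: "real \<Rightarrow> real \<Rightarrow> real \<Rightarrow> real \<Rightarrow> complex \<Rightarrow> complex" where
  "moebius a b c d z = to_uhp (frac_lin a b c d z)"

lemma denom_nonzero:
  assumes "Im z \<noteq> 0" "a * d - b * c \<noteq> (0::real)"
  shows "of_real c * z + of_real d \<noteq> 0"
proof
  assume "of_real c * z + of_real d = 0"
  then have "c * Re z + d = 0" "c * Im z = 0" by (auto simp: complex_eq_iff)
  then show False using assms by auto
qed

lemma frac_lin_cnj: "frac_lin a b c d (cnj z) = cnj (frac_lin a b c d z)"
  by (simp add: frac_lin_def)

lemma Im_frac_lin:
  assumes "Im z \<noteq> 0" "a * d - b * c \<noteq> 0"
  shows "Im (frac_lin a b c d z) = (a * d - b * c) * Im z / (cmod (of_real c * z + of_real d))\<^sup>2"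
  by (simp add: frac_lin_def Im_divide cmod_power2 algebra_simps)

lemma frac_lin_comp:
  assumes z: "Im z \<noteq> 0" and M: "a * d - b * c \<noteq> 0" and N: "a' * d' - b' * c' \<noteq> 0"
  shows "frac_lin a b c d (frac_lin a' b' c' d' z)
    = frac_lin (a * a' + b * c') (a * b' + b * d') (c * a' + d * c') (c * b' + d * d') z"
proof -
  define p where "p = of_real a' * z + of_real b'"
  define q where "q = of_real c' * z + of_real d'"
  have q: "q \<noteq> 0" unfolding q_def using denom_nonzero[OF z N] .
  have "frac_lin a b c d (p / q) = (of_real a * p + of_real b * q) / (of_real c * p + of_real d * q)"
  proof -
    have "of_real a * (p / q) + of_real b = (of_real a * p + of_real b * q) / q"
      "of_real c * (p / q) + of_real d = (of_real c * p + of_real d * q) / q"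
      using q by (simp_all add: add_divide_distrib)
    then show ?thesis using q by (simp add: frac_lin_def)
  qed
  moreover have "of_real a * p + of_real b * q = of_real (a * a' + b * c') * z + of_real (a * b' + b * d')"
    "of_real c * p + of_real d * q = of_real (c * a' + d * c') * z + of_real (c * b' + d * d')"
    by (simp_all add: p_def q_def algebra_simps)
  ultimately show ?thesis by (simp add: frac_lin_def p_def q_def)
qed

lemma to_uhp_in_uhp: "Im w \<noteq> 0 \<Longrightarrow> to_uhp w \<in> uhp"
  by (auto simp: to_uhp_def uhp_def)

lemma Im_frac_lin_nonzero:
  assumes "Im z \<noteq> 0" "a * d - b * c \<noteq> 0"
  shows "Im (frac_lin a b c d z) \<noteq> 0"
  using assms denom_nonzero[OF assms] by (simp add: Im_frac_lin)

lemma moebius_in_uhp: 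
  assumes "z \<in> uhp" "a * d - b * c \<noteq> 0" shows "moebius a b c d z \<in> uhp"
  unfolding moebius_def using assms by (intro to_uhp_in_uhp Im_frac_lin_nonzero) (auto simp: uhp_def)

lemma moebius_comp:
  assumes z: "z \<in> uhp" and M: "a * d - b * c \<noteq> 0" and N: "a' * d' - b' * c' \<noteq> 0"
  shows "moebius a b c d (moebius a' b' c' d' z)
    = moebius (a * a' + b * c') (a * b' + b * d') (c * a' + d * c') (c * b' + d * d') z"
proof -
  have Im: "Im z \<noteq> 0" using z by (simp add: uhp_def)
  define w where "w = frac_lin a' b' c' d' z"
  have w: "Im w \<noteq> 0" unfolding w_def using Im_frac_lin_nonzero[OF Im N] .
  have "to_uhp (frac_lin a b c d (cnj w)) = to_uhp (frac_lin a b c d w)"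
    using Im_frac_lin_nonzero[OF w M] unfolding frac_lin_cnj to_uhp_def by auto
  then have "to_uhp (frac_lin a b c d (to_uhp w)) = to_uhp (frac_lin a b c d w)" by (cases "Im w > 0") (simp_all add: to_uhp_def[of w])
  then show ?thesis unfolding moebius_def w_def frac_lin_comp[OF Im M N] .
qed

lemma moebius_scalar:
  assumes "z \<in> uhp" "q \<noteq> 0" shows "moebius q 0 0 q z = z"
  using assms by (simp add: moebius_def frac_lin_def to_uhp_def uhp_def)

lemma Im_moebius:
  assumes z: "z \<in> uhp" and M: "a * d - b * c \<noteq> 0"
  shows "Im (moebius a b c d z) = \<bar>a * d - b * c\<bar> * Im z / (cmod (of_real c * z + of_real d))\<^sup>2"
proof -
  have Im: "Im z > 0" using z by (simp add: uhp_def)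
  have "Im (moebius a b c d z) = \<bar>Im (frac_lin a b c d z)\<bar>" by (auto simp: moebius_def to_uhp_def)
  then show ?thesis using Im M by (simp add: Im_frac_lin abs_mult)
qed

text \<open>The determinant and the two denominators cancel between the difference of the images and the square
root of the product of their imaginary parts.\<close>

lemma hdist_moebius:
  assumes z: "z \<in> uhp" and w: "w \<in> uhp" and M: "a * d - b * c \<noteq> 0"
  shows "hdist (moebius a b c d z) (moebius a b c d w) = hdist z w"
proof -
  have Im: "Im z > 0" "Im w > 0" using z w by (simp_all add: uhp_def)
  define D where "D = a * d - b * c"
  define p where "p = of_real c * z + of_real d"
  define q where "q = of_real c * w + of_real d"
  have p0: "p \<noteq> 0" and q0: "q \<noteq> 0" unfolding p_def q_def using Im by (auto intro!: denom_nonzero[OF _ M])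
  have D0: "\<bar>D\<bar> > 0" using M by (simp add: D_def)
  have sgn: "Im (frac_lin a b c d z) > 0 \<longleftrightarrow> Im (frac_lin a b c d w) > 0"
    using Im M p0 q0 by (simp add: Im_frac_lin zero_less_divide_iff zero_less_mult_iff flip: p_def q_def)
  have "cmod (moebius a b c d z - moebius a b c d w) = cmod (frac_lin a b c d z - frac_lin a b c d w)"
    unfolding moebius_def to_uhp_def sgn by (simp only: complex_cnj_diff[symmetric] complex_mod_cnj split: if_split) simp
  also have "frac_lin a b c d z - frac_lin a b c d w
    = ((of_real a * z + of_real b) * q - (of_real a * w + of_real b) * p) / (p * q)"
    unfolding frac_lin_def p_def[symmetric] q_def[symmetric] using p0 q0 by (simp add: diff_frac_eq)
  also have "(of_real a * z + of_real b) * q - (of_real a * w + of_real b) * p = of_real D * (z - w)"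
    by (simp add: p_def q_def D_def algebra_simps)
  finally have num: "cmod (moebius a b c d z - moebius a b c d w) = \<bar>D\<bar> * cmod (z - w) / (cmod p * cmod q)"
    by (simp add: norm_mult norm_divide)
  have "Im (moebius a b c d z) * Im (moebius a b c d w) = (\<bar>D\<bar> / (cmod p * cmod q))\<^sup>2 * (Im z * Im w)"
  proof -
    have "A * x / P\<^sup>2 * (A * y / Q\<^sup>2) = (A / (P * Q))\<^sup>2 * (x * y)" for A x y P Q :: real
      by (simp add: power2_eq_square mult_ac)
    then show ?thesis unfolding Im_moebius[OF z M] Im_moebius[OF w M] D_def p_def q_def .
  qed
  then have "sqrt (Im (moebius a b c d z) * Im (moebius a b c d w)) = \<bar>D\<bar> / (cmod p * cmod q) * sqrt (Im z * Im w)"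
    by (simp add: real_sqrt_mult)
  then have "sinh (hdist (moebius a b c d z) (moebius a b c d w) / 2) = sinh (hdist z w / 2)"
    unfolding sinh_hdist[OF moebius_in_uhp[OF z M] moebius_in_uhp[OF w M]] sinh_hdist[OF z w] num
    using p0 q0 D0 by simp
  then show ?thesis by simp
qed

text \<open>Its logarithm is up to sign a Busemann function centred at the root \<open>- d / c\<close> (or at infinity, for
\<open>c = 0\<close>). The homogeneous coordinates \<open>c\<close>, \<open>d\<close> make a real matrix act on it linearly.\<close>

definition horo :: "real \<Rightarrow> real \<Rightarrow> complex \<Rightarrow> real" where
  "horo c d z = Im z / (cmod (of_real c * z + of_real d))\<^sup>2"

text \<open>Ptolemy's inequality for \<open>w\<close>, \<open>z\<close>, the conjugate of \<open>z\<close>, and the centre \<open>- d / c\<close>, which is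
equidistant from \<open>z\<close> and its conjugate. The homogeneous coordinates cover the centre at infinity as well.\<close>

lemma horo_le:
  assumes z: "z \<in> uhp" and w: "w \<in> uhp" and cd: "c \<noteq> 0 \<or> d \<noteq> 0"
  shows "horo c d z \<le> exp (hdist z w) * horo c d w"
proof -
  have Im: "Im z > 0" "Im w > 0" using z w by (simp_all add: uhp_def)
  define p where "p = of_real c * z + of_real d"
  define q where "q = of_real c * w + of_real d"
  have p0: "cmod p > 0" and q0: "cmod q > 0"
    using cd Im by (auto simp: p_def q_def complex_eq_iff)
  define sz sw where s: "sz = sqrt (Im z)" "sw = sqrt (Im w)"
  have s0: "sz > 0" "sw > 0" and s2: "sz\<^sup>2 = Im z" "sw\<^sup>2 = Im w" using Im by (auto simp: s)
  define E where "E = exp (hdist z w / 2)"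
  have "E = cosh (hdist z w / 2) + sinh (hdist z w / 2)"
    by (simp add: E_def cosh_plus_sinh)
  also have "\<dots> = (cmod (z - cnj w) + cmod (z - w)) / (2 * (sz * sw))"
    unfolding cosh_hdist[OF z w] sinh_hdist[OF z w] real_sqrt_mult s[symmetric] by (simp add: add_divide_distrib)
  finally have E: "2 * (sz * sw) * E = cmod (w - cnj z) + cmod (w - z)"
    using s0 by (simp add: cmod_diff_cnj_commute[of w z] norm_minus_commute)
  have "q * (z - cnj z) = p * (w - cnj z) - cnj p * (w - z)"
    by (simp add: p_def q_def algebra_simps)
  then have "cmod q * cmod (z - cnj z) \<le> cmod p * cmod (w - cnj z) + cmod p * cmod (w - z)"
    by (metis norm_mult norm_triangle_ineq4 complex_mod_cnj)
  moreover have "cmod (z - cnj z) = 2 * sz\<^sup>2"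
    using Im by (simp add: s2 complex_diff_cnj norm_mult)
  ultimately have "cmod q * (2 * sz\<^sup>2) \<le> cmod p * (2 * (sz * sw) * E)"
    unfolding E by (simp add: distrib_left)
  then have "(2 * sz) * (cmod q * sz) \<le> (2 * sz) * (cmod p * (sw * E))"
    by (simp add: power2_eq_square mult_ac)
  then have "cmod q * sz \<le> cmod p * (sw * E)" using s0 by simp
  then have "(cmod q * sz)\<^sup>2 \<le> (cmod p * (sw * E))\<^sup>2" using s0 by (intro power_mono) auto
  then have "(cmod q)\<^sup>2 * Im z \<le> (cmod p)\<^sup>2 * (Im w * E\<^sup>2)" by (simp add: power_mult_distrib s2)
  moreover have "E\<^sup>2 = exp (hdist z w)" by (simp add: E_def power2_eq_square flip: exp_add)
  ultimately show ?thesis unfolding horo_def p_def[symmetric] q_def[symmetric]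
    using p0 q0 by (simp add: field_simps)
qed

lemma horo_pos:
  assumes "z \<in> uhp" "c \<noteq> 0 \<or> d \<noteq> 0" shows "horo c d z > 0"
proof -
  have "of_real c * z + of_real d \<noteq> 0" using assms by (auto simp: complex_eq_iff uhp_def)
  then show ?thesis using assms by (simp add: horo_def uhp_def)
qed

lemma abs_ln_horo_diff_le:
  assumes z: "z \<in> uhp" and w: "w \<in> uhp" and cd: "c \<noteq> 0 \<or> d \<noteq> 0"
  shows "\<bar>ln (horo c d z) - ln (horo c d w)\<bar> \<le> hdist z w"
proof -
  have *: "ln (horo c d z) \<le> hdist z w + ln (horo c d w)" if z: "z \<in> uhp" and w: "w \<in> uhp" for z w
  proof -
    have "ln (horo c d z) \<le> ln (exp (hdist z w) * horo c d w)"
      using horo_le[OF z w cd] horo_pos[OF z cd] horo_pos[OF w cd] by (intro ln_mono) auto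
    then show ?thesis using horo_pos[OF w cd] by (simp add: ln_mult)
  qed
  show ?thesis using *[OF z w] *[OF w z] hdist_commute[of w z] by (simp add: abs_le_iff)
qed

text \<open>A left eigenvector of the matrix gives the coordinates of a fixed point at infinity.\<close>

lemma horo_moebius:
  assumes z: "z \<in> uhp" and M: "a * d - b * c \<noteq> 0"
    and eigen: "u * a + v * c = t * u" "u * b + v * d = t * v"
  shows "horo u v (moebius a b c d z) = \<bar>a * d - b * c\<bar> / t\<^sup>2 * horo u v z"
proof -
  have Im: "Im z \<noteq> 0" using z by (simp add: uhp_def)
  define p where "p = of_real c * z + of_real d"
  have p0: "p \<noteq> 0" using denom_nonzero[OF Im M] by (simp add: p_def)
  have "cmod (of_real u * moebius a b c d z + of_real v) = cmod (of_real u * frac_lin a b c d z + of_real v)"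
  proof (cases "Im (frac_lin a b c d z) > 0")
    case False
    have "of_real u * cnj (frac_lin a b c d z) + of_real v = cnj (of_real u * frac_lin a b c d z + of_real v)"
      by simp
    then show ?thesis using False by (simp only: moebius_def to_uhp_def if_False complex_mod_cnj)
  qed (simp add: moebius_def to_uhp_def)
  also have "of_real u * frac_lin a b c d z + of_real v = (of_real u * (of_real a * z + of_real b) + of_real v * p) / p"
    unfolding frac_lin_def p_def[symmetric] using p0 by (simp add: add_divide_distrib distrib_left)
  also have "of_real u * (of_real a * z + of_real b) + of_real v * p = of_real (u * a + v * c) * z + of_real (u * b + v * d)"
    by (simp add: p_def algebra_simps)
  also have "\<dots> = of_real t * (of_real u * z + of_real v)" unfolding eigen by (simp add: algebra_simps)
  finally have "cmod (of_real u * moebius a b c d z + of_real v) = \<bar>t\<bar> * cmod (of_real u * z + of_real v) / cmod p"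
    by (simp add: norm_mult norm_divide)
  then show ?thesis using p0
    unfolding horo_def Im_moebius[OF z M] p_def[symmetric] by (simp add: power_divide power_mult_distrib)
qed

text \<open>By the Cayley-Hamilton theorem the powers of a matrix of determinant 1 are combinations of the
matrix and the identity; the coefficients satisfy the recursion of \<open>sin (k * \<theta>)\<close>.\<close>

lemma moebius_funpow_elliptic:
  assumes det: "a * d - b * c = 1" and tr: "a + d = 2 * cos \<theta>" and s: "sin \<theta> \<noteq> 0" and z: "z \<in> uhp"
  defines "p \<equiv> \<lambda>k. sin (real k * \<theta>) / sin \<theta>" and "q \<equiv> \<lambda>k. - sin ((real k - 1) * \<theta>) / sin \<theta>"
  shows "(moebius a b c d ^^ k) z = moebius (p k * a + q k) (p k * b) (p k * c) (p k * d + q k) z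
    \<and> (p k * a + q k) * (p k * d + q k) - p k * b * (p k * c) = 1"
proof (induction k)
  case 0
  then show ?case using s z by (simp add: moebius_scalar p_def q_def)
next
  case (Suc k)
  define P Q P' Q' where PQ: "P = p k" "Q = q k" "P' = p (Suc k)" "Q' = q (Suc k)"
  have IH: "(moebius a b c d ^^ k) z = moebius (P * a + Q) (P * b) (P * c) (P * d + Q) z"
    "(P * a + Q) * (P * d + Q) - P * b * (P * c) = 1" using Suc by (simp_all add: PQ)
  have Q': "Q' = - P" by (simp add: PQ p_def q_def)
  have "sin (real k * \<theta> + \<theta>) + sin (real k * \<theta> - \<theta>) = 2 * cos \<theta> * sin (real k * \<theta>)"
    by (simp add: sin_add sin_diff)
  then have "P' = P * (2 * cos \<theta>) + Q"
    by (simp add: PQ p_def q_def algebra_simps flip: add_divide_distrib diff_divide_distrib)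
  then have P': "P' = P * (a + d) + Q" by (simp add: tr)
  have "a * d = 1 + b * c" using det by simp
  then have "P * (a * d) = P * (1 + b * c)" by simp
  then have entries: "a * (P * a + Q) + b * (P * c) = P' * a + Q'" "a * (P * b) + b * (P * d + Q) = P' * b"
    "c * (P * a + Q) + d * (P * c) = P' * c" "c * (P * b) + d * (P * d + Q) = P' * d + Q'"
    by (simp_all add: P' Q' algebra_simps)
  have "(moebius a b c d ^^ Suc k) z = moebius a b c d (moebius (P * a + Q) (P * b) (P * c) (P * d + Q) z)"
    by (simp add: IH)
  also have "\<dots> = moebius (P' * a + Q') (P' * b) (P' * c) (P' * d + Q') z"
    using moebius_comp[OF z, of a d b c "P * a + Q" "P * d + Q" "P * b" "P * c"] det IH(2)
    unfolding entries by simp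
  finally have 1: "(moebius a b c d ^^ Suc k) z = moebius (P' * a + Q') (P' * b) (P' * c) (P' * d + Q') z" .
  have "(a * (P * a + Q) + b * (P * c)) * (c * (P * b) + d * (P * d + Q)) - (a * (P * b) + b * (P * d + Q)) * (c * (P * a + Q) + d * (P * c))
    = (a * d - b * c) * ((P * a + Q) * (P * d + Q) - P * b * (P * c))" by algebra
  then have 2: "(P' * a + Q') * (P' * d + Q') - P' * b * (P' * c) = 1"
    unfolding entries det IH(2) by simp
  show ?case using 1 2 by (simp add: PQ)
qed

text \<open>The power is a scalar matrix, which acts trivially.\<close>

lemma moebius_rotation_order:
  assumes det: "a * d - b * c = 1" and tr: "a + d = - 2 * cos (pi / real k)" and k: "k \<ge> 2" and z: "z \<in> uhp"
  shows "(moebius a b c d ^^ k) z = z"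
proof -
  \<comment> \<open>The supplementary angle absorbs the sign of the trace.\<close>
  define \<theta> where "\<theta> = pi - pi / real k"
  have "0 < pi / real k" "pi / real k < pi" using k by (auto simp: field_simps)
  then have s: "sin \<theta> > 0" by (intro sin_gt_zero) (auto simp: \<theta>_def)
  have tr': "a + d = 2 * cos \<theta>" by (simp add: tr \<theta>_def cos_diff)
  have "real k * \<theta> = (real k - 1) * pi" using k by (simp add: \<theta>_def field_simps)
  then have "real k * \<theta> = real (k - 1) * pi" using k by simp
  then have "sin (real k * \<theta>) / sin \<theta> = 0" by simp
  moreover define q where "q = - sin ((real k - 1) * \<theta>) / sin \<theta>"
  ultimately have q: "(moebius a b c d ^^ k) z = moebius q 0 0 q z \<and> q * q = 1"
    using moebius_funpow_elliptic[OF det tr' less_imp_neq[OF s, symmetric] z, of k]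
    unfolding q_def[symmetric] by (simp only: mult_zero_left add_0 diff_0_right)
  then have "q \<noteq> 0" by auto
  then show ?thesis using q moebius_scalar[OF z] by simp
qed

text \<open>The characteristic polynomial has the discriminant \<open>(a + d)\<^sup>2 + 4\<close>, and its roots have product
\<open>- 1\<close> and nonzero sum.\<close>

lemma real_left_eigenvector:
  fixes a b c d :: real
  assumes det: "a * d - b * c = - 1" and tr: "a + d \<noteq> 0"
  obtains t u v where "u \<noteq> 0 \<or> v \<noteq> 0" "u * a + v * c = t * u" "u * b + v * d = t * v"
    "t \<noteq> 0" "t\<^sup>2 \<noteq> 1"
proof -
  define t where "t = (a + d + sqrt ((a + d)\<^sup>2 + 4)) / 2"
  define r where "r = sqrt ((a + d)\<^sup>2 + 4)"
  have r2: "r * r = (a + d) * (a + d) + 4" by (simp add: r_def flip: power2_eq_square)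
  have t: "t * t = t * (a + d) + 1"
    unfolding t_def r_def[symmetric] using r2 by (simp add: field_simps)
  have t0: "t \<noteq> 0" using t by auto
  have t1: "t\<^sup>2 \<noteq> 1" using t t0 tr by (simp add: power2_eq_square)
  show thesis
  \<comment> \<open>The first candidate \<open>(c, t - a)\<close> vanishes in the excluded case; then \<open>(t - d, b)\<close> does not.\<close>
  proof (cases "c = 0 \<and> t = a")
    case False
    show thesis
    proof (rule that[of c "t - a" t])
      show "c \<noteq> 0 \<or> t - a \<noteq> 0" using False by auto
      show "c * b + (t - a) * d = t * (t - a)" using t det by (simp add: algebra_simps)
    qed (auto simp: t0 t1 algebra_simps)
  next
    case True
    have "t - d \<noteq> 0"
    proof
      assume "t - d = 0"
      then have "t * t = - 1" using True det by simp
      then show False using zero_le_square[of t] by linarith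
    qed
    show thesis
    proof (rule that[of "t - d" b t])
      show "t - d \<noteq> 0 \<or> b \<noteq> 0" using \<open>t - d \<noteq> 0\<close> by auto
      show "(t - d) * a + b * c = t * (t - d)" using t det by (simp add: algebra_simps)
    qed (auto simp: t0 t1 algebra_simps)
  qed
qed

section \<open>Actions of groups generated by involutions\<close>

text \<open>The sign of a letter is ignored, since the generators act by involutions.\<close>

definition word_act :: "('g \<Rightarrow> 'x \<Rightarrow> 'x) \<Rightarrow> 'g word \<Rightarrow> 'x \<Rightarrow> 'x" where
  "word_act \<rho> w = foldr (\<lambda>(e, s). \<rho> s) w"

lemma word_act_simps [simp]:
  "word_act \<rho> [] x = x"
  "word_act \<rho> ((e, s) # w) x = \<rho> s (word_act \<rho> w x)"
  "word_act \<rho> (u @ w) x = word_act \<rho> u (word_act \<rho> w x)"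
  by (simp_all add: word_act_def)

lemma word_act_power: "word_act \<rho> (word_power w k) = (word_act \<rho> w ^^ k)"
  by (induction k) (auto simp: word_power_def fun_eq_iff)

lemma class_of_word [simp]: "word_rel R `` {w} \<in> carrier (presented_group R)"
  by (auto simp: presented_group_def quotient_def)

lemma carrier_presented_group_E:
  assumes "g \<in> carrier (presented_group R)"
  obtains w where "g = word_rel R `` {w}"
  using assms by (auto simp: presented_group_def quotient_def)

text \<open>Involutions that satisfy the relators define an action of the presented group.\<close>

locale involutions =
  fixes R :: "'g word set" and X :: "'x set" and \<rho> :: "'g \<Rightarrow> 'x \<Rightarrow> 'x"
  assumes closed: "\<And>s x. x \<in> X \<Longrightarrow> \<rho> s x \<in> X"
    and invol: "\<And>s x. x \<in> X \<Longrightarrow> \<rho> s (\<rho> s x) = x"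
    and relators: "\<And>r x. r \<in> R \<Longrightarrow> x \<in> X \<Longrightarrow> word_act \<rho> r x = x"
begin

lemma word_act_closed: "x \<in> X \<Longrightarrow> word_act \<rho> w x \<in> X"
  by (induction w) (auto simp: closed)

lemma word_act_cong:
  assumes "word_equiv R u v" and "x \<in> X"
  shows "word_act \<rho> u x = word_act \<rho> v x"
  using assms by (induction arbitrary: x rule: word_equiv.induct)
    (simp_all add: word_act_closed invol relators)

lemma word_act_rev: "x \<in> X \<Longrightarrow> word_act \<rho> (rev w) (word_act \<rho> w x) = x"
  by (induction w) (auto simp: word_act_closed invol)

lemma word_act_bij: "bij_betw (word_act \<rho> w) X X"
proof (rule bij_betw_byWitness[of _ "word_act \<rho> (rev w)"])
  show "\<forall>x\<in>X. word_act \<rho> w (word_act \<rho> (rev w) x) = x"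
    using word_act_rev[of _ "rev w"] by simp
qed (auto simp: word_act_rev word_act_closed)

text \<open>Any representative acts in the same way (\<open>word_act_cong\<close>). The restriction is there because
\<open>BijGroup\<close> consists of extensional functions.\<close>

definition class_act :: "'g word set \<Rightarrow> 'x \<Rightarrow> 'x" where
  "class_act U = restrict (word_act \<rho> (SOME u. u \<in> U)) X"

lemma class_act_word:
  assumes "x \<in> X" shows "class_act (word_rel R `` {w}) x = word_act \<rho> w x"
proof -
  have "w \<in> word_rel R `` {w}" by (simp add: word_rel_def word_equiv.refl)
  then have "(SOME u. u \<in> word_rel R `` {w}) \<in> word_rel R `` {w}" by (rule someI)
  then have "word_equiv R w (SOME u. u \<in> word_rel R `` {w})" by (simp add: word_rel_def)
  then show ?thesis using assms word_act_cong by (simp add: class_act_def)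
qed

lemma class_act_in_Bij: "class_act U \<in> Bij X"
  unfolding class_act_def Bij_def using word_act_bij
  by (simp add: bij_betw_restrict_eq)

lemma isometric_action_class_act:
  assumes isom: "\<And>s x y. x \<in> X \<Longrightarrow> y \<in> X \<Longrightarrow> d (\<rho> s x) (\<rho> s y) = d x y"
  shows "isometric_action (presented_group R) X d class_act"
  unfolding isometric_action_def
proof (intro conjI ballI)
  have "class_act \<in> hom (presented_group R) (BijGroup X)"
  proof (rule homI)
    fix U V assume U: "U \<in> carrier (presented_group R)" and V: "V \<in> carrier (presented_group R)"
    obtain u v where u: "U = word_rel R `` {u}" and v: "V = word_rel R `` {v}"
      using carrier_presented_group_E U V by metis
    have "class_act (U \<otimes>\<^bsub>presented_group R\<^esub> V) = compose X (class_act U) (class_act V)"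
    proof (rule extensionalityI[of _ X])
      show "class_act (U \<otimes>\<^bsub>presented_group R\<^esub> V) \<in> extensional X" by (simp add: class_act_def)
      fix x assume "x \<in> X"
      then show "class_act (U \<otimes>\<^bsub>presented_group R\<^esub> V) x = compose X (class_act U) (class_act V) x"
        by (simp add: u v presented_group_mult class_act_word compose_eq word_act_closed)
    qed simp
    then show "class_act (U \<otimes>\<^bsub>presented_group R\<^esub> V) = class_act U \<otimes>\<^bsub>BijGroup X\<^esub> class_act V"
      by (simp add: BijGroup_def class_act_in_Bij)
  qed (simp add: BijGroup_def class_act_in_Bij)
  then show "group_action (presented_group R) X class_act"
    by (simp add: group_action_def group_hom_def group_hom_axioms_def group_presented_group group_BijGroup)
  fix g x y assume g: "g \<in> carrier (presented_group R)" and xy: "x \<in> X" "y \<in> X"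
  have "d (word_act \<rho> w x) (word_act \<rho> w y) = d x y" for w
    by (induction w) (auto simp: isom word_act_closed xy)
  then show "d (class_act g x) (class_act g y) = d x y"
    using g xy by (auto elim!: carrier_presented_group_E simp: class_act_word)
qed

end

text \<open>The function bounds the orbit distances from below, and repeated use of the triangle inequality
along the orbit bounds them from above.\<close>

lemma loxodromic_if_lipschitz_translation:
  fixes f :: "'x \<Rightarrow> real"
  assumes M: "Metric_space X d" and act: "isometric_action G X d \<phi>"
    and g: "g \<in> carrier G" and x: "x \<in> X"
    and lip: "\<And>p q. p \<in> X \<Longrightarrow> q \<in> X \<Longrightarrow> \<bar>f p - f q\<bar> \<le> d p q"
    and shift: "\<And>p. p \<in> X \<Longrightarrow> f (\<phi> g p) = f p + \<tau>" and \<tau>: "\<tau> \<noteq> 0"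
  shows "loxodromic G X d \<phi> g"
proof -
  interpret Metric_space X d by fact
  interpret A: group_action G X \<phi> using act by (simp add: isometric_action_def)
  interpret G: group G using A.group_hom by (rule group_hom.axioms)
  have isom: "d (\<phi> h p) (\<phi> h q) = d p q" if "h \<in> carrier G" "p \<in> X" "q \<in> X" for h p q
    using act that by (simp add: isometric_action_def)
  have mem: "\<phi> h p \<in> X" if "h \<in> carrier G" "p \<in> X" for h p
    using A.element_image that by blast
  define orb where "orb k = \<phi> (g [^]\<^bsub>G\<^esub> k) x" for k :: int
  have orb_in: "orb k \<in> X" for k unfolding orb_def using g x by (intro mem) auto
  have orb_0: "orb 0 = x" using x by (simp add: orb_def flip: A.id_eq_one)
  have orb_Suc: "orb (k + 1) = \<phi> g (orb k)" for k
  proof -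
    have "g [^]\<^bsub>G\<^esub> (k + 1) = g [^]\<^bsub>G\<^esub> (1 + k)" by (simp add: add.commute)
    also have "\<dots> = g \<otimes>\<^bsub>G\<^esub> g [^]\<^bsub>G\<^esub> k" using g by (simp only: G.int_pow_mult G.int_pow_1)
    finally have "g [^]\<^bsub>G\<^esub> (k + 1) = g \<otimes>\<^bsub>G\<^esub> g [^]\<^bsub>G\<^esub> k" .
    then show ?thesis unfolding orb_def using A.composition_rule[OF x g] g by simp
  qed
  have step: "d (orb (k + 1)) (orb k) = d (orb 1) (orb 0)" for k
  proof (induction k rule: int_induct[of _ 0])
    case (step1 k)
    then show ?case by (metis orb_Suc isom[OF g orb_in orb_in])
  next
    case (step2 k)
    then show ?case using isom[OF g orb_in orb_in, of k "k - 1"] orb_Suc[of "k - 1"] orb_Suc[of k] by simp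
  qed simp
  have fo: "f (orb k) = f x + real_of_int k * \<tau>" for k
  proof (induction k rule: int_induct[of _ 0])
    case (step2 k)
    then show ?case using shift[OF orb_in, of "k - 1"] orb_Suc[of "k - 1"] by (simp add: algebra_simps)
  qed (simp_all add: orb_0 orb_Suc shift orb_in algebra_simps)
  have upper: "d (orb (k + int n)) (orb k) \<le> real n * d (orb 1) (orb 0)" for k n
  proof (induction n)
    case (Suc n)
    have "d (orb (k + int n + 1)) (orb k) \<le> d (orb (k + int n + 1)) (orb (k + int n)) + d (orb (k + int n)) (orb k)"
      by (intro triangle orb_in)
    then show ?case using Suc step[of "k + int n"] by (simp add: algebra_simps)
  qed (simp add: orb_in)
  have upper': "d (orb a) (orb b) \<le> \<bar>real_of_int a - real_of_int b\<bar> * d (orb 1) (orb 0)" for a b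
  proof (cases "b \<le> a")
    case True
    then show ?thesis using upper[of b "nat (a - b)"] by simp
  next
    case False
    then show ?thesis using upper[of a "nat (b - a)"] by (simp add: commute)
  qed
  have lower: "\<bar>\<tau>\<bar> * \<bar>real_of_int a - real_of_int b\<bar> \<le> d (orb a) (orb b)" for a b
  proof -
    have "\<bar>\<tau>\<bar> * \<bar>real_of_int a - real_of_int b\<bar> = \<bar>f (orb a) - f (orb b)\<bar>"
      by (simp add: fo abs_mult[symmetric] algebra_simps)
    then show ?thesis using lip[OF orb_in orb_in, of a b] by simp
  qed
  \<comment> \<open>One constant for both bounds: \<open>1 / C\<close> is at most the shift \<open>\<bar>\<tau>\<bar>\<close> and \<open>C\<close> at least the length of one step.\<close>
  define C where "C = max 1 (max (1 / \<bar>\<tau>\<bar>) (d (orb 1) (orb 0)))"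
  have C: "C \<ge> 1" "1 / \<bar>\<tau>\<bar> \<le> C" "d (orb 1) (orb 0) \<le> C" by (auto simp: C_def)
  have C': "1 / C \<le> \<bar>\<tau>\<bar>" using C(1,2) \<tau> by (simp add: field_simps)
  have "quasi_isometric_embedding UNIV (\<lambda>a b. dist (real_of_int a) (real_of_int b)) X d orb"
    unfolding quasi_isometric_embedding_def
  proof (intro conjI exI[of _ C] ballI C(1))
    show "orb \<in> UNIV \<rightarrow> X" using orb_in by auto
    fix a b :: int
    have "1 / C * dist (real_of_int a) (real_of_int b) \<le> \<bar>\<tau>\<bar> * \<bar>real_of_int a - real_of_int b\<bar>"
      unfolding dist_real_def using C' by (intro mult_right_mono) auto
    with lower[of a b] C(1) show "1 / C * dist (real_of_int a) (real_of_int b) - C \<le> d (orb a) (orb b)" by linarith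
    have "\<bar>real_of_int a - real_of_int b\<bar> * d (orb 1) (orb 0) \<le> C * dist (real_of_int a) (real_of_int b)"
      unfolding dist_real_def using C(3) by (simp add: mult.commute mult_right_mono)
    with upper'[of a b] C(1) show "d (orb a) (orb b) \<le> C * dist (real_of_int a) (real_of_int b) + C" by linarith
  qed
  then show ?thesis unfolding loxodromic_def orb_def[abs_def] using x by blast
qed


section \<open>A loxodromic element for hyperbolic angles\<close>

text \<open>The difference of the two sides is \<open>cos \<beta> - cos (\<pi> - (\<alpha> + \<gamma>))\<close>, and the cosine decreases.\<close>

lemma hyperbolic_angle_ineq:
  assumes hyp: "hyperbolic_triangle l m n" and "l \<ge> 2" "m \<ge> 2" "n \<ge> 2"
  shows "sin (pi / real l) * sin (pi / real n)
    < cos (pi / real m) + cos (pi / real l) * cos (pi / real n)"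
proof -
  define \<alpha> \<beta> \<gamma> where ang: "\<alpha> = pi / real l" "\<beta> = pi / real m" "\<gamma> = pi / real n"
  have "0 < \<alpha>" "0 < \<beta>" "0 < \<gamma>" using assms by (auto simp: ang)
  moreover have "\<alpha> + \<beta> + \<gamma> < pi" using hyp by (simp add: hyperbolic_triangle_def ang)
  ultimately have "cos (pi - (\<alpha> + \<gamma>)) < cos \<beta>" by (intro cos_monotone_0_pi) auto
  then show ?thesis by (simp add: cos_diff cos_add flip: ang)
qed

text \<open>The product and the sum of \<open>u\<close> and \<open>v\<close> are prescribed, so they are the roots of a quadratic
polynomial; the strict inequality makes its discriminant positive.\<close>

lemma exists_third_mirror:
  assumes s: "s > 0" and x: "x\<^sup>2 + s\<^sup>2 = 1" and r: "r > 0" and z: "z\<^sup>2 + r\<^sup>2 = 1"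
    and less: "s * r < y + x * z"
  obtains u v :: real where "z * z + u * v = 1" "s * (u + v) = - 2 * (y + x * z)" "u \<noteq> v"
proof -
  \<comment> \<open>The roots are \<open>- h\<close> plus and minus the square root of \<open>h\<^sup>2 - r\<^sup>2\<close>, where \<open>r\<^sup>2 = 1 - z\<^sup>2\<close> is their product.\<close>
  define h where "h = (y + x * z) / s"
  have "r < h" using less s by (simp add: h_def pos_less_divide_eq mult.commute)
  then have "r\<^sup>2 < h\<^sup>2" using r by (intro power_strict_mono) auto
  define q where "q = sqrt (h\<^sup>2 - r\<^sup>2)"
  have q: "q > 0" "q * q = h\<^sup>2 - r\<^sup>2" using \<open>r\<^sup>2 < h\<^sup>2\<close> by (auto simp: q_def simp flip: power2_eq_square)
  show thesis
  proof (rule that[of "- h + q" "- h - q"])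
    have "(- h + q) * (- h - q) = r\<^sup>2" using q(2) by (simp add: power2_eq_square algebra_simps)
    then show "z * z + (- h + q) * (- h - q) = 1" using z by (simp add: power2_eq_square)
    show "s * ((- h + q) + (- h - q)) = - 2 * (y + x * z)" using s by (simp add: h_def)
  qed (use q in simp)
qed

lemma exists_inj_complex:
  fixes \<iota> :: "real \<Rightarrow> 'x"
  assumes "inj \<iota>" obtains j :: "complex \<Rightarrow> 'x" where "inj j"
proof -
  have "\<not> finite (UNIV :: real set)" by (rule infinite_UNIV_char_0)
  then have "\<exists>p. bij_betw p ((UNIV :: real set) \<times> (UNIV :: real set)) (UNIV :: real set)"
    unfolding card_of_ordIso by (rule card_of_Times_same_infinite)
  then obtain p :: "real \<times> real \<Rightarrow> real" where "inj p"
    unfolding bij_betw_def by auto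
  moreover have "inj (\<lambda>z. (Re z, Im z))" by (auto simp: inj_def complex_eq_iff)
  ultimately have "inj (\<iota> \<circ> p \<circ> (\<lambda>z. (Re z, Im z)))" using assms by (intro inj_compose)
  then show thesis by (rule that)
qed


text \<open>The reflections are given by the trace-free matrices with the rows \<open>(1,0),(0,-1)\<close>, \<open>(-x,s),(s,x)\<close> and
\<open>(-z,u),(v,z)\<close>, where \<open>x\<close>, \<open>y\<close>, \<open>z\<close> are the cosines of the angles and \<open>s\<close> is the sine of the first one. The equations for \<open>u\<close> and \<open>v\<close> say that the third matrix
has determinant \<open>- 1\<close> and that the product of the last two has trace \<open>- 2 * y\<close>. The trace of the product of
all three is \<open>s * (v - u)\<close>, and \<open>u \<noteq> v\<close> is the hyperbolicity of the triangle.\<close>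

lemma exists_reflection_triangle:
  assumes hyp: "hyperbolic_triangle l m n" and l: "l \<ge> 2" and m: "m \<ge> 2" and n: "n \<ge> 2"
  obtains A B C :: "complex \<Rightarrow> complex" and f and \<tau> :: real
  where "\<And>M z. M \<in> {A, B, C} \<Longrightarrow> z \<in> uhp \<Longrightarrow> M z \<in> uhp \<and> M (M z) = z"
    and "\<And>M z w. M \<in> {A, B, C} \<Longrightarrow> z \<in> uhp \<Longrightarrow> w \<in> uhp \<Longrightarrow> hdist (M z) (M w) = hdist z w"
    and "\<And>z. z \<in> uhp \<Longrightarrow> ((A \<circ> B) ^^ l) z = z"
    and "\<And>z. z \<in> uhp \<Longrightarrow> ((B \<circ> C) ^^ m) z = z"
    and "\<And>z. z \<in> uhp \<Longrightarrow> ((A \<circ> C) ^^ n) z = z"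
    and "\<And>z w. z \<in> uhp \<Longrightarrow> w \<in> uhp \<Longrightarrow> \<bar>f z - f w\<bar> \<le> hdist z w"
    and "\<And>z. z \<in> uhp \<Longrightarrow> f (A (B (C z))) = f z + \<tau>" and "\<tau> \<noteq> 0"
proof -
  define x y z s r where d: "x = cos (pi / real l)" "y = cos (pi / real m)" "z = cos (pi / real n)"
    "s = sin (pi / real l)" "r = sin (pi / real n)"
  have "0 < pi / real k \<and> pi / real k < pi" if "k \<ge> 2" for k :: nat
    using that by (auto simp: field_simps)
  then have s0: "s > 0" and r0: "r > 0" using l n by (auto simp: d intro: sin_gt_zero)
  have xs: "x\<^sup>2 + s\<^sup>2 = 1" and zr: "z\<^sup>2 + r\<^sup>2 = 1" by (simp_all add: d)
  have less: "s * r < y + x * z" using hyperbolic_angle_ineq[OF hyp l m n] by (simp add: d)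
  obtain u v where uv: "z * z + u * v = 1" "s * (u + v) = - 2 * (y + x * z)" "u \<noteq> v"
    using exists_third_mirror[OF s0 xs r0 zr less] by blast
  have xs': "x * x + s * s = 1" using xs by (simp add: power2_eq_square)
  define A B C where ABC: "A = moebius 1 0 0 (- 1)" "B = moebius (- x) s s x" "C = moebius (- z) u v z"
  have dets: "1 * (- 1) - 0 * 0 \<noteq> (0 :: real)" "- x * x - s * s \<noteq> 0" "- z * z - u * v \<noteq> 0"
    using xs' uv(1) by linarith+
  have closed: "A p \<in> uhp" "B p \<in> uhp" "C p \<in> uhp" if "p \<in> uhp" for p
    unfolding ABC using that dets by (auto intro!: moebius_in_uhp)
  have invol: "A (A p) = p" "B (B p) = p" "C (C p) = p" if p: "p \<in> uhp" for p
  proof -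
    show "A (A p) = p" unfolding ABC moebius_comp[OF p dets(1) dets(1)] using moebius_scalar[OF p, of 1] by simp
    have sx: "s * s + x * x = 1" using xs' by simp
    then show "B (B p) = p" unfolding ABC moebius_comp[OF p dets(2) dets(2)] using moebius_scalar[OF p, of 1] by (simp add: xs' sx)
    have vu: "z * z + u * v = 1" "z * u = u * z" "v * u + z * z = 1" "v * z = z * v" using uv(1) by (simp_all add: mult.commute)
    then show "C (C p) = p" unfolding ABC moebius_comp[OF p dets(3) dets(3)] using moebius_scalar[OF p, of 1] by (simp add: vu)
  qed
  have comp: "A (B p) = moebius (- x) s (- s) (- x) p" "B (C p) = moebius (x * z + s * v) (s * z - x * u) (x * v - s * z) (s * u + x * z) p"
    "A (C p) = moebius (- z) u (- v) (- z) p" if p: "p \<in> uhp" for p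
    unfolding ABC moebius_comp[OF p dets(1) dets(2)] moebius_comp[OF p dets(2) dets(3)] moebius_comp[OF p dets(1) dets(3)]
    by (simp_all add: algebra_simps)
  have funpow_eq: "(F ^^ k) p = p" 
    if "\<And>p. p \<in> uhp \<Longrightarrow> F p = G p" "\<And>p. p \<in> uhp \<Longrightarrow> G p \<in> uhp" "(G ^^ k) p = p" "p \<in> uhp"
    for F G :: "complex \<Rightarrow> complex" and k p
  proof -
    have "(F ^^ i) p = (G ^^ i) p \<and> (G ^^ i) p \<in> uhp" for i
      using that by (induction i) auto
    then show ?thesis using that(3) by simp
  qed
  have AB: "((A \<circ> B) ^^ l) p = p" if p: "p \<in> uhp" for p
  proof (rule funpow_eq[of _ "moebius (- x) s (- s) (- x)"])
    show "(moebius (- x) s (- s) (- x) ^^ l) p = p"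
      by (rule moebius_rotation_order[OF _ _ l p]) (use xs' in \<open>simp_all add: d\<close>)
    show "moebius (- x) s (- s) (- x) q \<in> uhp" if "q \<in> uhp" for q using xs' that by (intro moebius_in_uhp) auto
  qed (simp_all add: comp p)
  have AC: "((A \<circ> C) ^^ n) p = p" if p: "p \<in> uhp" for p
  proof (rule funpow_eq[of _ "moebius (- z) u (- v) (- z)"])
    show "(moebius (- z) u (- v) (- z) ^^ n) p = p"
      by (rule moebius_rotation_order[OF _ _ n p]) (use uv(1) in \<open>simp_all add: d\<close>)
    show "moebius (- z) u (- v) (- z) q \<in> uhp" if "q \<in> uhp" for q using uv(1) that by (intro moebius_in_uhp) auto
  qed (simp_all add: comp p)
  have detBC: "(x * z + s * v) * (s * u + x * z) - (s * z - x * u) * (x * v - s * z) = 1"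
  proof -
    have "(x * z + s * v) * (s * u + x * z) - (s * z - x * u) * (x * v - s * z) = (x * x + s * s) * (z * z + u * v)"
      by algebra
    then show ?thesis by (simp add: xs' uv(1))
  qed
  have BC: "((B \<circ> C) ^^ m) p = p" if p: "p \<in> uhp" for p
  proof (rule funpow_eq[of _ "moebius (x * z + s * v) (s * z - x * u) (x * v - s * z) (s * u + x * z)"])
    have "(x * z + s * v) + (s * u + x * z) = - 2 * cos (pi / real m)"
      using uv(2) by (simp add: algebra_simps d(2))
    then show "(moebius (x * z + s * v) (s * z - x * u) (x * v - s * z) (s * u + x * z) ^^ m) p = p"
      by (rule moebius_rotation_order[OF detBC _ m p])
    show "moebius (x * z + s * v) (s * z - x * u) (x * v - s * z) (s * u + x * z) q \<in> uhp" if "q \<in> uhp" for q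
      using detBC that by (intro moebius_in_uhp) auto
  qed (simp_all add: comp p)
  define a b c e where M: "a = x * z + s * v" "b = s * z - x * u" "c = s * z - x * v" "e = - s * u - x * z"
  have detM: "a * e - b * c = - 1" using detBC by (simp add: M algebra_simps)
  have prod: "A (B (C p)) = moebius a b c e p" if p: "p \<in> uhp" for p
  proof -
    have det0: "(x * z + s * v) * (s * u + x * z) - (s * z - x * u) * (x * v - s * z) \<noteq> 0" using detBC by simp
    show ?thesis unfolding comp(2)[OF p] ABC(1) moebius_comp[OF p dets(1) det0] by (simp add: M)
  qed
  have "a + e = s * (v - u)" by (simp add: M algebra_simps)
  then have "a + e \<noteq> 0" using s0 uv(3) by simp
  then obtain t p q where eig: "p \<noteq> 0 \<or> q \<noteq> 0" "p * a + q * c = t * p" "p * b + q * e = t * q" "t \<noteq> 0" "t\<^sup>2 \<noteq> 1"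
    by (rule real_left_eigenvector[OF detM])
  show thesis
  proof (rule that[of A B C "\<lambda>w. ln (horo p q w)" "- ln (t\<^sup>2)"])
    show "hdist (M w) (M w') = hdist w w'" if "M \<in> {A, B, C}" "w \<in> uhp" "w' \<in> uhp" for M w w'
      using that dets by (auto simp: ABC intro!: hdist_moebius)
    show "\<bar>ln (horo p q w) - ln (horo p q w')\<bar> \<le> hdist w w'" if "w \<in> uhp" "w' \<in> uhp" for w w'
      using abs_ln_horo_diff_le[OF that eig(1)] .
    show "ln (horo p q (A (B (C w)))) = ln (horo p q w) + - ln (t\<^sup>2)" if w: "w \<in> uhp" for w
    proof -
      have "horo p q (moebius a b c e w) = horo p q w / t\<^sup>2"
        using horo_moebius[OF w _ eig(2,3)] detM by simp
      then show ?thesis unfolding prod[OF w] using horo_pos[OF w eig(1)] eig(4) by (simp add: ln_div)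
    qed
    have "ln (t\<^sup>2) \<noteq> 0" using eig(4,5) by (subst ln_eq_zero_iff) auto
    then show "- ln (t\<^sup>2) \<noteq> 0" by simp
  qed (use closed invol AB BC AC in auto)
qed

lemma not_property_NL_if_hyperbolic:
  fixes \<iota> :: "real \<Rightarrow> 'x"
  assumes \<iota>: "inj \<iota>" and hyp: "hyperbolic_triangle l m n" and l: "l \<ge> 2" and m: "m \<ge> 2" and n: "n \<ge> 2"
  shows "\<not> property_NL TYPE('x) (triangle_group l m n)"
proof (rule exists_reflection_triangle[OF hyp l m n])
  fix A B C :: "complex \<Rightarrow> complex" and f and \<tau> :: real
  assume inv: "\<And>M z. M \<in> {A, B, C} \<Longrightarrow> z \<in> uhp \<Longrightarrow> M z \<in> uhp \<and> M (M z) = z"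
    and isom: "\<And>M z w. M \<in> {A, B, C} \<Longrightarrow> z \<in> uhp \<Longrightarrow> w \<in> uhp \<Longrightarrow> hdist (M z) (M w) = hdist z w"
    and rel: "\<And>z. z \<in> uhp \<Longrightarrow> ((A \<circ> B) ^^ l) z = z"
      "\<And>z. z \<in> uhp \<Longrightarrow> ((B \<circ> C) ^^ m) z = z"
      "\<And>z. z \<in> uhp \<Longrightarrow> ((A \<circ> C) ^^ n) z = z"
    and lip: "\<And>z w. z \<in> uhp \<Longrightarrow> w \<in> uhp \<Longrightarrow> \<bar>f z - f w\<bar> \<le> hdist z w"
    and shift: "\<And>z. z \<in> uhp \<Longrightarrow> f (A (B (C z))) = f z + \<tau>" and \<tau>: "\<tau> \<noteq> 0"
  obtain j :: "complex \<Rightarrow> 'x" where j: "inj j" using exists_inj_complex[OF \<iota>] .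
  define X where "X = j ` uhp"
  define k where "k = inv_into uhp j"
  define d where "d x y = hdist (k x) (k y)" for x y
  have injon: "inj_on j uhp" using j by (rule inj_on_subset) simp
  have kj: "k (j z) = z" if "z \<in> uhp" for z using that injon by (simp add: k_def)
  have kX: "k x \<in> uhp" "j (k x) = x" if "x \<in> X" for x
    using that by (auto simp: X_def kj)
  have jX: "j z \<in> X" if "z \<in> uhp" for z using that by (simp add: X_def)
  have hypX: "hyperbolic_space X d"
    unfolding X_def d_def k_def by (rule hyperbolic_space_copy_uhp[OF injon])
  define \<rho>0 where "\<rho>0 s = (case s of Gen_a \<Rightarrow> A | Gen_b \<Rightarrow> B | Gen_c \<Rightarrow> C)" for s
  have \<rho>0: "\<rho>0 s \<in> {A, B, C}" for s by (cases s) (auto simp: \<rho>0_def)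
  define \<rho> where "\<rho> s x = j (\<rho>0 s (k x))" for s x
  have act: "word_act \<rho>0 w z \<in> uhp \<and> word_act \<rho> w (j z) = j (word_act \<rho>0 w z)" if "z \<in> uhp" for w z
  proof (induction w)
    case (Cons a w)
    then show ?case using inv[OF \<rho>0] by (cases a) (simp add: \<rho>_def kj)
  qed (simp add: that)
  interpret involutions "triangle_relators l m n" X \<rho>
  proof
    show "\<rho> s x \<in> X" if "x \<in> X" for s x using inv[OF \<rho>0] kX(1)[OF that] by (simp add: \<rho>_def jX)
    show "\<rho> s (\<rho> s x) = x" if "x \<in> X" for s x using inv[OF \<rho>0] kX[OF that] by (simp add: \<rho>_def kj)
    fix r x assume r: "r \<in> triangle_relators l m n" and x: "x \<in> X"
    have "word_act \<rho>0 r (k x) = k x"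
    proof -
      have p2: "(F ^^ 2) z = F (F z)" for F :: "complex \<Rightarrow> complex" and z by (simp add: numeral_2_eq_2)
      have single: "word_act \<rho>0 [(True, s)] = \<rho>0 s" for s by (simp add: fun_eq_iff)
      have pair: "word_act \<rho>0 [(True, s), (True, s')] = \<rho>0 s \<circ> \<rho>0 s'" for s s' by (simp add: fun_eq_iff)
      show ?thesis using r inv kX(1)[OF x] rel
        by (auto simp: triangle_relators_def Let_def word_act_power p2 single pair \<rho>0_def)
    qed
    then show "word_act \<rho> r x = x" using act[OF kX(1)[OF x]] kX(2)[OF x] by simp
  qed
  have "isometric_action (presented_group (triangle_relators l m n)) X d class_act"
    by (rule isometric_action_class_act) (use inv[OF \<rho>0] in \<open>simp add: d_def \<rho>_def kj kX isom[OF \<rho>0]\<close>)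
  then have iso: "isometric_action (triangle_group l m n) X d class_act" by (simp add: triangle_group_def)
  define w where "w = [(True, Gen_a), (True, Gen_b), (True, Gen_c)]"
  define g where "g = word_rel (triangle_relators l m n) `` {w}"
  have g: "g \<in> carrier (triangle_group l m n)" by (simp add: g_def triangle_group_def)
  have gx: "k (class_act g x) = A (B (C (k x)))" if x: "x \<in> X" for x
  proof -
    have "class_act g x = word_act \<rho> w (j (k x))" using class_act_word[OF x] kX(2)[OF x] by (simp add: g_def)
    then show ?thesis using act[OF kX(1)[OF x], of w] by (simp add: kj) (simp add: w_def \<rho>0_def)
  qed
  have "\<i> \<in> uhp" by (simp add: uhp_def)
  then have "loxodromic (triangle_group l m n) X d class_act g"
    using hypX lip kX(1) shift
    by (intro loxodromic_if_lipschitz_translation[OF _ iso g jX[of \<i>], of "\<lambda>x. f (k x)" \<tau>] \<tau>)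
      (auto simp: hyperbolic_space_def geodesic_space_def d_def gx)
  moreover have "X \<noteq> {}" using jX[OF \<open>\<i> \<in> uhp\<close>] by blast
  ultimately show ?thesis unfolding property_NL_def using hypX iso g by blast
qed

section \<open>Growth of displacements under commuting isometries\<close>

locale four_point_space = Metric_space X d for X :: "'x set" and d +
  fixes K :: real and x0 :: 'x
  assumes fp: "four_point X d K" and x0: "x0 \<in> X"
begin

text \<open>Isometries are total functions here, of which only the restriction to \<open>X\<close> matters to the metric.
Extending the action by the identity outside \<open>X\<close> keeps the relations of the group as equations
between total functions, so that they can be used for rewriting.\<close>

definition isom :: "('x \<Rightarrow> 'x) \<Rightarrow> bool" where
  "isom f \<longleftrightarrow> (\<forall>x\<in>X. f x \<in> X) \<and> (\<forall>x\<in>X. \<forall>y\<in>X. d (f x) (f y) = d x y)"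

definition disp :: "('x \<Rightarrow> 'x) \<Rightarrow> real" where
  "disp f = d x0 (f x0)"

lemma isom_id: "isom id" by (simp add: isom_def)

lemma isom_comp: "isom f \<Longrightarrow> isom g \<Longrightarrow> isom (f \<circ> g)" by (simp add: isom_def)

lemma isom_funpow: "isom f \<Longrightarrow> isom (f ^^ k)"
  by (induction k) (auto intro: isom_comp simp: isom_id)

lemma isomD: "isom f \<Longrightarrow> x \<in> X \<Longrightarrow> f x \<in> X"
  "isom f \<Longrightarrow> x \<in> X \<Longrightarrow> y \<in> X \<Longrightarrow> d (f x) (f y) = d x y"
  by (simp_all add: isom_def)

lemma disp_comp_le:
  assumes f: "isom f" and g: "isom g" shows "disp (f \<circ> g) \<le> disp f + disp g"
proof -
  have "d x0 (f (g x0)) \<le> d x0 (f x0) + d (f x0) (f (g x0))"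
    by (intro triangle x0 isomD(1)[OF f] isomD(1)[OF g])
  then show ?thesis using isomD(2)[OF f x0 isomD(1)[OF g x0]] by (simp add: disp_def)
qed

text \<open>Growth at most logarithmic along powers of two. It is inherited by products of commuting isometries
and under conjugation and excludes linear growth, and unlike the vanishing of the stable translation
length it does not mention a limit.\<close>

definition slow :: "('x \<Rightarrow> 'x) \<Rightarrow> bool" where
  "slow f \<longleftrightarrow> (\<exists>\<alpha> \<beta>. \<forall>i. disp (f ^^ (2 ^ i)) \<le> \<alpha> + \<beta> * real i)"

text \<open>A bounded difference of displacements stands for equality of stable translation lengths.\<close>

definition close :: "('x \<Rightarrow> 'x) \<Rightarrow> ('x \<Rightarrow> 'x) \<Rightarrow> bool" where
  "close f g \<longleftrightarrow> (\<exists>c. \<forall>k. \<bar>disp (f ^^ k) - disp (g ^^ k)\<bar> \<le> c)"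

lemma close_sym: "close f g \<Longrightarrow> close g f"
  by (simp add: close_def abs_minus_commute)

lemma close_trans:
  assumes "close f g" "close g h" shows "close f h"
proof -
  obtain c where c: "\<And>k. \<bar>disp (f ^^ k) - disp (g ^^ k)\<bar> \<le> c" using assms(1) by (auto simp: close_def)
  obtain c' where c': "\<And>k. \<bar>disp (g ^^ k) - disp (h ^^ k)\<bar> \<le> c'" using assms(2) by (auto simp: close_def)
  have "\<bar>disp (f ^^ k) - disp (h ^^ k)\<bar> \<le> c + c'" for k
    using c[of k] c'[of k] by linarith
  then show ?thesis unfolding close_def by blast
qed

lemma slow_close:
  assumes "slow f" "close f g" shows "slow g"
proof -
  obtain \<alpha> \<beta> where s: "\<And>i. disp (f ^^ (2 ^ i)) \<le> \<alpha> + \<beta> * real i" using assms(1) by (auto simp: slow_def)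
  obtain c where c: "\<And>k. \<bar>disp (f ^^ k) - disp (g ^^ k)\<bar> \<le> c" using assms(2) by (auto simp: close_def)
  have "disp (g ^^ (2 ^ i)) \<le> (\<alpha> + c) + \<beta> * real i" for i
    using s[of i] c[of "2 ^ i"] by (simp add: abs_le_iff)
  then show ?thesis unfolding slow_def by blast
qed

lemma comp_funpow_conj:
  assumes "q \<circ> f = g \<circ> q" shows "q \<circ> (f ^^ k) = (g ^^ k) \<circ> q"
proof (rule ext)
  fix x
  have "q (f y) = g (q y)" for y using assms by (metis comp_apply)
  then show "(q \<circ> (f ^^ k)) x = ((g ^^ k) \<circ> q) x" by (induction k) simp_all
qed

text \<open>Conjugation amounts to a change of the base point from \<open>x0\<close> to \<open>q x0\<close>. The equation \<open>q \<circ> f = g \<circ> q\<close> expresses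
it without an inverse of \<open>q\<close>.\<close>

lemma close_conj:
  assumes q: "isom q" and f: "isom f" and g: "isom g" and eq: "q \<circ> f = g \<circ> q"
  shows "close f g"
proof -
  have "\<bar>disp (f ^^ k) - disp (g ^^ k)\<bar> \<le> 2 * disp q" for k
  proof -
    have pts: "q x0 \<in> X" "(f ^^ k) x0 \<in> X" "(g ^^ k) x0 \<in> X" "(g ^^ k) (q x0) \<in> X"
      using isomD(1)[OF q x0] isomD(1)[OF isom_funpow[OF f] x0] isomD(1)[OF isom_funpow[OF g]] x0 by auto
    have "(g ^^ k) (q x0) = q ((f ^^ k) x0)" using comp_funpow_conj[OF eq, of k] by (simp add: fun_eq_iff)
    then have 1: "d (q x0) ((g ^^ k) (q x0)) = disp (f ^^ k)"
      using isomD(2)[OF q x0 pts(2)] by (simp add: disp_def)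
    have 2: "d ((g ^^ k) (q x0)) ((g ^^ k) x0) = disp q"
      using isomD(2)[OF isom_funpow[OF g] pts(1) x0] by (simp add: disp_def commute)
    have "disp (g ^^ k) \<le> d x0 (q x0) + d (q x0) ((g ^^ k) (q x0)) + d ((g ^^ k) (q x0)) ((g ^^ k) x0)"
      unfolding disp_def using triangle[OF x0 pts(1,3)] triangle[OF pts(1,4,3)] by simp
    moreover have "d (q x0) ((g ^^ k) (q x0)) \<le> d (q x0) x0 + d x0 ((g ^^ k) x0) + d ((g ^^ k) x0) ((g ^^ k) (q x0))"
      using triangle[OF pts(1) x0 pts(4)] triangle[OF x0 pts(3,4)] by simp
    ultimately show ?thesis using 1 2 by (simp add: disp_def commute[of "q x0" x0] commute[of "(g ^^ k) x0"] abs_le_iff)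
  qed
  then show ?thesis unfolding close_def by blast
qed

lemma funpow_comp_inverse:
  fixes f g :: "'b \<Rightarrow> 'b"
  assumes "f \<circ> g = id" shows "(f ^^ k) \<circ> (g ^^ k) = id"
proof (rule ext)
  fix x
  have "f (g y) = y" for y using assms by (metis comp_apply id_apply)
  then have "(f ^^ k) ((g ^^ k) x) = x" by (induction k) (simp_all add: funpow_swap1[of f])
  then show "((f ^^ k) \<circ> (g ^^ k)) x = id x" by simp
qed

lemma close_inverse:
  assumes f: "isom f" and g: "isom g" and inv: "f \<circ> g = id"
  shows "close f g"
proof -
  have "disp (g ^^ k) = disp (f ^^ k)" for k
  proof -
    have "(f ^^ k) ((g ^^ k) x0) = x0" using funpow_comp_inverse[OF inv, of k] by (simp add: fun_eq_iff)
    then show ?thesis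
      using isomD(2)[OF isom_funpow[OF f] x0 isomD(1)[OF isom_funpow[OF g] x0], of k k]
      by (simp add: disp_def commute)
  qed
  then show ?thesis by (auto simp: close_def)
qed

lemma funpow_comp_commute:
  assumes "f \<circ> g = g \<circ> f" shows "(f \<circ> g) ^^ k = (f ^^ k) \<circ> (g ^^ k)"
proof (rule ext)
  fix x
  have "g ((f ^^ k) y) = (f ^^ k) (g y)" for k y
    using comp_funpow_conj[of g f f k] assms by (metis comp_apply)
  then show "((f \<circ> g) ^^ k) x = ((f ^^ k) \<circ> (g ^^ k)) x" by (induction k) simp_all
qed

lemma funpow_commute:
  assumes "f \<circ> g = g \<circ> f" shows "(f ^^ k) \<circ> (g ^^ k) = (g ^^ k) \<circ> (f ^^ k)"
  using funpow_comp_commute[OF assms, of k] funpow_comp_commute[OF assms[symmetric], of k] assms by simp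

lemma slow_comp:
  assumes f: "isom f" and g: "isom g" and fg: "f \<circ> g = g \<circ> f" and "slow f" "slow g"
  shows "slow (f \<circ> g)"
proof -
  obtain \<alpha> \<beta> where s: "\<And>i. disp (f ^^ (2 ^ i)) \<le> \<alpha> + \<beta> * real i" using assms by (auto simp: slow_def)
  obtain \<alpha>' \<beta>' where s': "\<And>i. disp (g ^^ (2 ^ i)) \<le> \<alpha>' + \<beta>' * real i" using assms by (auto simp: slow_def)
  have "disp ((f \<circ> g) ^^ (2 ^ i)) \<le> (\<alpha> + \<alpha>') + (\<beta> + \<beta>') * real i" for i
    using disp_comp_le[OF isom_funpow[OF f] isom_funpow[OF g], of "2 ^ i" "2 ^ i"] s[of i] s'[of i]
    by (simp add: funpow_comp_commute[OF fg] distrib_right)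
  then show ?thesis unfolding slow_def by blast
qed

lemma slow_id: "slow id"
  unfolding slow_def by (rule exI[of _ 0], rule exI[of _ 0]) (simp add: disp_def x0)

lemma slow_if_doubling:
  assumes "\<And>k. disp (f ^^ (2 * k)) \<le> disp (f ^^ k) + c" shows "slow f"
proof -
  have "disp (f ^^ (2 ^ i)) \<le> disp f + c * real i" for i
  proof (induction i)
    case (Suc i)
    then show ?case using assms[of "2 ^ i"] by (simp add: algebra_simps)
  qed simp
  then show ?thesis unfolding slow_def by blast
qed

text \<open>The four-point inequality for \<open>x0\<close>, \<open>f (g x0)\<close>, \<open>f x0\<close>, \<open>g x0\<close>: opposite sides of this
quadrilateral have equal length because \<open>f\<close> and \<open>g\<close> commute.\<close>

lemma disp_quadrilateral:
  assumes f: "isom f" and g: "isom g" and fg: "f \<circ> g = g \<circ> f" and h: "isom h" and inv: "f \<circ> h = id"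
  shows "disp (f \<circ> g) + disp (h \<circ> g) \<le> 2 * max (disp f) (disp g) + K"
proof -
  have pts: "f x0 \<in> X" "g x0 \<in> X" "f (g x0) \<in> X" "h (g x0) \<in> X" using f g h x0 by (simp_all add: isomD)
  have "d x0 (f (g x0)) + d (f x0) (g x0) \<le> max (d x0 (f x0) + d (f (g x0)) (g x0)) (d x0 (g x0) + d (f (g x0)) (f x0)) + K"
    by (rule four_pointD[OF fp x0 pts(3,1,2)])
  moreover have "d (f (g x0)) (g x0) = disp f"
    using isomD(2)[OF g pts(1) x0] fg by (simp add: disp_def commute fun_eq_iff)
  moreover have "d (f (g x0)) (f x0) = disp g"
    using isomD(2)[OF f pts(2) x0] by (simp add: disp_def commute)
  moreover have "d (f x0) (g x0) = disp (h \<circ> g)"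
    using isomD(2)[OF f x0 pts(4)] inv by (simp add: disp_def fun_eq_iff)
  ultimately show ?thesis by (simp add: disp_def max_def split: if_splits)
qed

text \<open>Write \<open>L\<close>, \<open>L'\<close>, \<open>U\<close>, \<open>V\<close> for the displacements of the powers of \<open>f\<close>, \<open>g\<close>, \<open>fg\<close>, \<open>f\<inverse>g\<close>. The quadrilateral
spanned by \<open>f\<close> and \<open>g\<close> gives \<open>U + V \<le> 2 * L\<close> up to constants, and the one with diagonals \<open>f\<^sup>2\<close> and \<open>g\<^sup>2\<close> gives
\<open>2 * L (2 * k) \<le> 2 * max (U k) (V k)\<close>. The two alternatives in the last hypothesis come from a rotation
of order 3 and of order 4; with either of them \<open>U\<close> and \<open>V\<close> are both at most \<open>L\<close> up to constants, hence
\<open>L (2 * k) \<le> L k + const\<close>.\<close>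

lemma slow_if_rotated:
  assumes f: "isom f" and g: "isom g" and fg: "f \<circ> g = g \<circ> f"
    and h: "isom h" and inv: "f \<circ> h = id" "h \<circ> f = id"
    and fg_close: "close f g"
    and prod_close: "close (f \<circ> g) f \<or> close (f \<circ> g) (h \<circ> g)"
  shows "slow f"
proof -
  have hg: "h \<circ> g = g \<circ> h"
  proof -
    have "h \<circ> g = h \<circ> (g \<circ> f) \<circ> h" using inv by (simp add: comp_assoc)
    also have "\<dots> = (h \<circ> f) \<circ> (g \<circ> h)" by (simp add: comp_assoc flip: fg)
    finally show ?thesis using inv by simp
  qed
  define L where "L k = disp (f ^^ k)" for k
  define L' where "L' k = disp (g ^^ k)" for k
  define U where "U k = disp ((f \<circ> g) ^^ k)" for k
  define V where "V k = disp ((h \<circ> g) ^^ k)" for k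
  obtain c where c: "\<And>k. \<bar>L k - L' k\<bar> \<le> c" using fg_close by (auto simp: close_def L_def L'_def)
  have UV: "U k + V k \<le> 2 * max (L k) (L' k) + K" for k
    unfolding U_def V_def L_def L'_def funpow_comp_commute[OF fg] funpow_comp_commute[OF hg]
    by (intro disp_quadrilateral isom_funpow f g h funpow_commute fg funpow_comp_inverse inv)
  have LL: "L' (2 * k) + L (2 * k) \<le> 2 * max (U k) (V k) + K" for k
  proof -
    note F = funpow_comp_commute[OF fg, of k] and H = funpow_comp_commute[OF hg, of k]
    let ?f = "f ^^ k" and ?g = "g ^^ k" and ?h = "h ^^ k"
    have e: "?f \<circ> ?g = ?g \<circ> ?f" "?h \<circ> ?g = ?g \<circ> ?h" "?f \<circ> ?h = id" "?h \<circ> ?f = id"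
      by (intro funpow_commute funpow_comp_inverse fg hg inv)+
    have e': "?f (?g x) = ?g (?f x)" "?h (?g x) = ?g (?h x)" "?f (?h x) = x" "?h (?f x) = x" for x
      using e by (simp_all add: fun_eq_iff)
    have two: "q ^^ (2 * k) = (q ^^ k) \<circ> (q ^^ k)" for q :: "'x \<Rightarrow> 'x"
      by (simp add: mult_2 funpow_add)
    have pts: "?f x0 \<in> X" "?g x0 \<in> X" "?h x0 \<in> X" "?g (?f x0) \<in> X" "?g (?g x0) \<in> X" "?g (?h x0) \<in> X" "?h (?h x0) \<in> X" "?f (?f x0) \<in> X"
      using f g h x0 by (simp_all add: isomD isom_funpow)
    have "d x0 (?g (?g x0)) + d (?f (?g x0)) (?h (?g x0)) 
      \<le> max (d x0 (?f (?g x0)) + d (?g (?g x0)) (?h (?g x0))) (d x0 (?h (?g x0)) + d (?g (?g x0)) (?f (?g x0))) + K"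
      by (rule four_pointD[OF fp x0 pts(5)]) (use pts e' in simp_all)
    moreover have "d x0 (?g (?g x0)) = L' (2 * k)" by (simp add: L'_def two disp_def)
    moreover have "d (?f (?g x0)) (?h (?g x0)) = L (2 * k)"
    proof -
      have "d (?f (?g x0)) (?h (?g x0)) = d (?f x0) (?h x0)"
        using isomD(2)[OF isom_funpow[OF g] pts(1,3)] by (simp add: e')
      also have "\<dots> = d (?f (?f x0)) (?f (?h x0))" using isomD(2)[OF isom_funpow[OF f] pts(1,3)] by simp
      finally show ?thesis by (simp add: e' L_def two disp_def commute)
    qed
    moreover have "d x0 (?f (?g x0)) = U k" by (simp add: U_def F disp_def)
    moreover have "d x0 (?h (?g x0)) = V k" by (simp add: V_def H disp_def)
    moreover have "d (?g (?g x0)) (?h (?g x0)) = U k"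
    proof -
      have "d (?g (?g x0)) (?h (?g x0)) = d (?g x0) (?h x0)"
        using isomD(2)[OF isom_funpow[OF g] pts(2,3)] by (simp add: e')
      also have "\<dots> = d (?f (?g x0)) (?f (?h x0))" using isomD(2)[OF isom_funpow[OF f] pts(2,3)] by simp
      finally show ?thesis by (simp add: e' U_def F disp_def commute)
    qed
    moreover have "d (?g (?g x0)) (?f (?g x0)) = V k"
    proof -
      have "d (?g (?g x0)) (?f (?g x0)) = d (?g x0) (?f x0)"
        using isomD(2)[OF isom_funpow[OF g] pts(2,1)] by (simp add: e')
      also have "\<dots> = d (?h (?g x0)) (?h (?f x0))" using isomD(2)[OF isom_funpow[OF h] pts(2,1)] by simp
      finally show ?thesis by (simp add: e' V_def H disp_def commute)
    qed
    ultimately show ?thesis by (simp add: max_def split: if_splits)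
  qed
  have LL': "L' k \<le> L k + c" "L k \<le> L' k + c" for k using c[of k] by (simp_all add: abs_le_iff)
  obtain e where e: "e \<ge> 0" "\<And>k. max (U k) (V k) \<le> L k + e"
  proof -
    from prod_close consider (1) "close (f \<circ> g) f" | (2) "close (f \<circ> g) (h \<circ> g)" by blast
    then show thesis
    proof cases
      case 1
      then obtain c' where c': "\<And>k. \<bar>U k - L k\<bar> \<le> c'" by (auto simp: close_def L_def U_def)
      show thesis
      proof (rule that[of "\<bar>c'\<bar> + 2 * \<bar>c\<bar> + \<bar>K\<bar>"])
        show "max (U k) (V k) \<le> L k + (\<bar>c'\<bar> + 2 * \<bar>c\<bar> + \<bar>K\<bar>)" for k
          using UV[of k] LL'[of k] c'[of k] by (auto simp: max_def abs_if split: if_splits)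
      qed simp
    next
      case 2
      then obtain c' where c': "\<And>k. \<bar>U k - V k\<bar> \<le> c'" by (auto simp: close_def V_def U_def)
      show thesis
      proof (rule that[of "\<bar>c'\<bar> + \<bar>c\<bar> + \<bar>K\<bar>"])
        show "max (U k) (V k) \<le> L k + (\<bar>c'\<bar> + \<bar>c\<bar> + \<bar>K\<bar>)" for k
          using UV[of k] LL'[of k] c'[of k] by (auto simp: max_def abs_if split: if_splits)
      qed simp
    qed
  qed
  have "L (2 * k) \<le> L k + (e + \<bar>K\<bar> + \<bar>c\<bar>)" for k
    using LL[of k] e(2)[of k] LL'[of "2 * k"] by linarith
  then show ?thesis unfolding L_def by (rule slow_if_doubling)
qed

text \<open>Only the lower bound of a quasi-isometric embedding, on nonnegative powers.\<close>

definition fast :: "('x \<Rightarrow> 'x) \<Rightarrow> bool" where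
  "fast f \<longleftrightarrow> (\<exists>C\<ge>1. \<forall>k. real k / C - C \<le> disp (f ^^ k))"

lemma not_fast_if_power_slow:
  assumes "slow (f ^^ M)" "M \<ge> 1" shows "\<not> fast f"
proof
  assume "fast f"
  then obtain C where C: "C \<ge> 1" "\<And>k. real k / C - C \<le> disp (f ^^ k)" by (auto simp: fast_def)
  obtain \<alpha> \<beta> where s: "\<And>i. disp ((f ^^ M) ^^ (2 ^ i)) \<le> \<alpha> + \<beta> * real i" using assms by (auto simp: slow_def)
  have le: "2 ^ i / C - C \<le> \<alpha> + \<beta> * real i" for i
  proof -
    have "2 ^ i / C \<le> real (M * 2 ^ i) / C" using assms(2) C(1) by (intro divide_right_mono) simp_all
    also have "\<dots> - C \<le> disp (f ^^ (M * 2 ^ i))" by (rule C(2))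
    also have "f ^^ (M * 2 ^ i) = (f ^^ M) ^^ (2 ^ i)" by (simp add: funpow_mult)
    also have "disp \<dots> \<le> \<alpha> + \<beta> * real i" by (rule s)
    finally show ?thesis by simp
  qed
  have "((\<lambda>i. (\<alpha> + C + \<beta> * real i) / 2 ^ i) \<longlongrightarrow> 0) at_top" by real_asymp
  then have "eventually (\<lambda>i. (\<alpha> + C + \<beta> * real i) / 2 ^ i < 1 / C) at_top"
    using C(1) by (intro order_tendstoD) auto
  then obtain i where "(\<alpha> + C + \<beta> * real i) / 2 ^ i < 1 / C" by (auto simp: eventually_at_top_linorder)
  then have "\<alpha> + C + \<beta> * real i < 2 ^ i / C" by (simp add: field_simps)
  with le[of i] show False by simp
qed

end

section \<open>Subgroups of finite index among transformations\<close>

text \<open>The generated submonoid of the transformations. It is a group for the sets that occur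
below, as they are closed under inverses; thus no inverse function has to be mentioned.\<close>

inductive_set gen :: "('x \<Rightarrow> 'x) set \<Rightarrow> ('x \<Rightarrow> 'x) set" for S where
  gen_id: "id \<in> gen S"
| gen_step: "s \<in> S \<Longrightarrow> f \<in> gen S \<Longrightarrow> s \<circ> f \<in> gen S"

lemma gen_base: "s \<in> S \<Longrightarrow> s \<in> gen S"
  using gen_step[OF _ gen_id, of s S] by simp

lemma gen_comp: "f \<in> gen S \<Longrightarrow> g \<in> gen S \<Longrightarrow> f \<circ> g \<in> gen S"
  by (induction rule: gen.induct) (auto simp: comp_assoc intro: gen.intros)

lemma gen_funpow: "f \<in> gen S \<Longrightarrow> f ^^ k \<in> gen S"
  by (induction k) (auto intro: gen_comp gen_id)

lemma gen_right_induct: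
  assumes "f \<in> gen S" and "P id" and "\<And>f s. P f \<Longrightarrow> s \<in> S \<Longrightarrow> P (f \<circ> s)"
  shows "P f"
proof -
  have "P (g \<circ> f)" if "P g" for g
    using assms(1) that
  proof (induction arbitrary: g rule: gen.induct)
    case (gen_step s f)
    then show ?case using gen_step.IH[OF assms(3)[OF gen_step.prems gen_step.hyps(1)]] by (simp add: comp_assoc)
  qed simp
  from this[OF assms(2)] show ?thesis by simp
qed

lemma gen_right_inverse:
  assumes "f \<in> gen S" and "\<And>s. s \<in> S \<Longrightarrow> \<exists>s'\<in>S. s \<circ> s' = id"
  shows "\<exists>g\<in>gen S. f \<circ> g = id"
  using assms(1)
proof (induction rule: gen.induct)
  case (gen_step s f)
  then obtain g s' where "g \<in> gen S" "f \<circ> g = id" "s' \<in> S" "s \<circ> s' = id" using assms(2) by blast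
  then have "(s \<circ> f) \<circ> (g \<circ> s') = id" by (metis comp_assoc comp_id)
  then show ?case using \<open>g \<in> gen S\<close> \<open>s' \<in> S\<close> gen_comp gen_base by blast
next
  case gen_id
  show ?case by (intro bexI[of _ id] gen.gen_id) simp_all
qed

text \<open>With \<open>r = x \<circ> y\<close>, every element is a power of \<open>r\<close>, possibly followed by a single \<open>x\<close> on the right.\<close>

lemma finite_gen_dihedral:
  assumes x: "x \<circ> x = id" and y: "y \<circ> y = id" and k: "(x \<circ> y) ^^ k = id" "k \<ge> 1"
  shows "finite (gen {x, y})"
proof -
  define r where "r = x \<circ> y"
  define F where "F = {r ^^ (i mod k) \<circ> e | i e. e \<in> {id, x}}"
  have red: "r ^^ i = r ^^ (i mod k)" for i
  proof -
    have "r ^^ i = r ^^ (i mod k + k * (i div k))" by simp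
    also have "\<dots> = r ^^ (i mod k) \<circ> (r ^^ k) ^^ (i div k)" by (simp only: funpow_add funpow_mult)
    finally show ?thesis using k by (simp add: r_def)
  qed
  have inF: "r ^^ i \<circ> e \<in> F" if "e \<in> {id, x}" for i e
    unfolding F_def using that red[of i] by auto
  \<comment> \<open>From \<open>x = r \<circ> y\<close>, since \<open>r ^^ (k - 1)\<close> is the inverse of \<open>r\<close>.\<close>
  have y_eq: "y = r ^^ (k - 1) \<circ> x"
  proof -
    have "r ^^ (k - 1) \<circ> x = r ^^ (k - 1) \<circ> (r \<circ> y)" using y by (simp add: r_def comp_assoc)
    also have "\<dots> = r ^^ (Suc (k - 1)) \<circ> y" by (simp only: funpow_Suc_right comp_assoc)
    finally show ?thesis using k by (simp add: r_def del: funpow.simps)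
  qed
  have "F = (\<lambda>(i, e). r ^^ i \<circ> e) ` ((\<lambda>i. i mod k) ` UNIV \<times> {id, x})" by (force simp: F_def)
  moreover have "finite ((\<lambda>i. i mod k) ` (UNIV :: nat set))"
    by (rule finite_subset[of _ "{..<k}"]) (use k in auto)
  ultimately have "finite F" by simp
  moreover have "f \<in> F" if "f \<in> gen {x, y}" for f
    using that
  proof (rule gen_right_induct)
    show "id \<in> F" using inF[of id 0] by simp
    fix f s assume "f \<in> F" "s \<in> {x, y}"
    then obtain i e where f: "f = r ^^ i \<circ> e" "e \<in> {id, x}" by (auto simp: F_def)
    consider "s = x" "e = id" | "s = x" "e = x" | "s = y" "e = id" | "s = y" "e = x"
      using f \<open>s \<in> {x, y}\<close> by blast
    then show "f \<circ> s \<in> F"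
    proof cases
      case 1 then show ?thesis using inF[of x i] f by simp
    next
      case 2 then show ?thesis using inF[of id i] f x by (simp add: comp_assoc)
    next
      case 3
      then have "f \<circ> s = r ^^ (i + (k - 1)) \<circ> x" using f y_eq by (simp add: funpow_add comp_assoc)
      then show ?thesis using inF[of x] by simp
    next
      case 4
      then have "f \<circ> s = r ^^ Suc i" using f by (simp add: comp_assoc funpow_Suc_right r_def del: funpow.simps)
      then show ?thesis using inF[of id "Suc i"] by simp
    qed
  qed
  ultimately show ?thesis by (meson finite_subset subsetI)
qed

text \<open>Coset enumeration: \<open>V\<close> represents the right cosets of the subgroup generated by \<open>D\<close>, and the last
hypothesis is the coset table.\<close>

lemma finite_gen_if_finite_index:
  assumes D: "finite (gen D)" and V: "finite V" "id \<in> V"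
    and step: "\<And>v s. v \<in> V \<Longrightarrow> s \<in> S \<Longrightarrow> \<exists>u\<in>gen D. \<exists>v'\<in>V. v \<circ> s = u \<circ> v'"
  shows "finite (gen S)"
proof -
  define F where "F = (\<lambda>(u, v). u \<circ> v) ` (gen D \<times> V)"
  have "f \<in> F" if "f \<in> gen S" for f
    using that
  proof (rule gen_right_induct)
    show "id \<in> F" unfolding F_def by (rule image_eqI[of _ _ "(id, id)"]) (use V in \<open>simp_all add: gen_id\<close>)
    fix f s assume "f \<in> F" and s: "s \<in> S"
    then obtain u v where uv: "f = u \<circ> v" "u \<in> gen D" "v \<in> V" by (auto simp: F_def)
    obtain u' v' where "u' \<in> gen D" "v' \<in> V" "v \<circ> s = u' \<circ> v'" using step[OF uv(3) s] by blast
    then have "f \<circ> s = (u \<circ> u') \<circ> v'" "(u \<circ> u', v') \<in> gen D \<times> V"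
      using uv gen_comp by (simp_all only: comp_assoc mem_Sigma_iff simp_thms)
    then show "f \<circ> s \<in> F" unfolding F_def by (intro image_eqI[of _ _ "(u \<circ> u', v')"]) simp_all
  qed
  then have "gen S \<subseteq> F" by blast
  moreover have "finite F" unfolding F_def using D V by simp
  ultimately show ?thesis by (rule finite_subset)
qed

text \<open>By the pigeonhole principle two powers of \<open>f\<close> have the same factor \<open>\<delta>\<close>, which cancels in their
quotient.\<close>

lemma power_in_finite_index:
  assumes f: "f \<in> gen S"
    and fact: "\<And>f. f \<in> gen S \<Longrightarrow> \<exists>\<tau>\<in>gen T. \<exists>\<delta>\<in>gen D. f = \<tau> \<circ> \<delta>"
    and D: "finite (gen D)" "\<And>s. s \<in> D \<Longrightarrow> s \<circ> s = id"
    and T: "\<And>s. s \<in> T \<Longrightarrow> \<exists>s'\<in>T. s \<circ> s' = id"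
  shows "\<exists>M\<ge>1. f ^^ M \<in> gen T"
proof -
  have "\<forall>i::nat. \<exists>\<delta>\<in>gen D. \<exists>\<tau>\<in>gen T. f ^^ i = \<tau> \<circ> \<delta>"
    using fact[OF gen_funpow[OF f]] by blast
  then obtain \<delta> where \<delta>: "\<And>i::nat. \<delta> i \<in> gen D" "\<And>i. \<exists>\<tau>\<in>gen T. f ^^ i = \<tau> \<circ> \<delta> i"
    by metis
  have "range \<delta> \<subseteq> gen D" using \<delta>(1) by blast
  then have "finite (range \<delta>)" using D(1) finite_subset by blast
  then have "\<not> inj \<delta>" using finite_imageD infinite_UNIV_nat by blast
  then obtain i j where "i < j" "\<delta> i = \<delta> j" unfolding inj_def by (metis nat_neq_iff)
  then obtain \<tau> \<tau>' where \<tau>: "\<tau> \<in> gen T" "\<tau>' \<in> gen T" "f ^^ i = \<tau> \<circ> \<delta> i" "f ^^ j = \<tau>' \<circ> \<delta> i"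
    using \<delta>(2) by metis
  obtain e where e: "\<delta> i \<circ> e = id" using gen_right_inverse[OF \<delta>(1)] D(2) by blast
  obtain \<sigma> where \<sigma>: "\<sigma> \<in> gen T" "\<tau> \<circ> \<sigma> = id" using gen_right_inverse[OF \<tau>(1) T] by blast
  have "f ^^ (j - i) \<circ> (\<tau> \<circ> \<delta> i) = \<tau>' \<circ> \<delta> i"
    using \<open>i < j\<close> \<tau> funpow_add[of "j - i" i f] by simp
  then have "f ^^ (j - i) \<circ> (\<tau> \<circ> \<delta> i) \<circ> e = \<tau>' \<circ> \<delta> i \<circ> e" by simp
  then have "f ^^ (j - i) \<circ> \<tau> = \<tau>'" using e by (simp add: comp_assoc)
  then have "f ^^ (j - i) \<circ> \<tau> \<circ> \<sigma> = \<tau>' \<circ> \<sigma>" by simp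
  then have "f ^^ (j - i) = \<tau>' \<circ> \<sigma>" using \<sigma> by (simp add: comp_assoc)
  then have "f ^^ (j - i) \<in> gen T" using gen_comp[OF \<tau>(2) \<sigma>(1)] by simp
  then show ?thesis using \<open>i < j\<close> by (intro exI[of _ "j - i"]) auto
qed

lemma gen_conj:
  assumes "\<tau> \<in> gen T" and "\<And>\<tau>. \<tau> \<in> T \<Longrightarrow> \<exists>\<sigma>\<in>gen T. s \<circ> \<tau> = \<sigma> \<circ> s"
  shows "\<exists>\<sigma>\<in>gen T. s \<circ> \<tau> = \<sigma> \<circ> s"
  using assms(1)
proof (induction rule: gen.induct)
  case (gen_step t \<tau>)
  then obtain \<sigma> \<sigma>' where "\<sigma> \<in> gen T" "s \<circ> \<tau> = \<sigma> \<circ> s" "\<sigma>' \<in> gen T" "s \<circ> t = \<sigma>' \<circ> s"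
    using assms(2)[OF gen_step.hyps(1)] by blast
  then have "s \<circ> (t \<circ> \<tau>) = (\<sigma>' \<circ> \<sigma>) \<circ> s" by (metis comp_assoc)
  then show ?case using \<open>\<sigma> \<in> gen T\<close> \<open>\<sigma>' \<in> gen T\<close> gen_comp by blast
next
  case gen_id
  show ?case by (intro bexI[of _ id] gen.gen_id) simp_all
qed

text \<open>As \<open>D\<close> normalises the submonoid generated by \<open>T\<close>, the product of the two submonoids is closed under
multiplication.\<close>

lemma semidirect_factorization:
  assumes f: "f \<in> gen S"
    and conj: "\<And>s \<tau>. s \<in> D \<Longrightarrow> \<tau> \<in> T \<Longrightarrow> \<exists>\<sigma>\<in>gen T. s \<circ> \<tau> = \<sigma> \<circ> s"
    and S: "\<And>s. s \<in> S \<Longrightarrow> \<exists>\<tau>\<in>gen T. \<exists>\<delta>\<in>gen D. s = \<tau> \<circ> \<delta>"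
  shows "\<exists>\<tau>\<in>gen T. \<exists>\<delta>\<in>gen D. f = \<tau> \<circ> \<delta>"
proof -
  have conj1: "\<exists>\<sigma>\<in>gen T. s \<circ> \<tau> = \<sigma> \<circ> s" if "\<tau> \<in> gen T" "s \<in> D" for s \<tau>
    using gen_conj[OF that(1) conj[OF that(2)]] .
  have conj2: "\<exists>\<sigma>\<in>gen T. \<delta> \<circ> \<tau> = \<sigma> \<circ> \<delta>" if "\<delta> \<in> gen D" "\<tau> \<in> gen T" for \<delta> \<tau>
    using that
  proof (induction rule: gen.induct)
    case (gen_step s \<delta>)
    then obtain \<sigma> where "\<sigma> \<in> gen T" "\<delta> \<circ> \<tau> = \<sigma> \<circ> \<delta>" by blast
    moreover then obtain \<sigma>' where "\<sigma>' \<in> gen T" "s \<circ> \<sigma> = \<sigma>' \<circ> s" using conj1 gen_step.hyps by blast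
    ultimately have "\<sigma>' \<in> gen T" "(s \<circ> \<delta>) \<circ> \<tau> = \<sigma>' \<circ> (s \<circ> \<delta>)" by (simp, metis comp_assoc)
    then show ?case by blast
  qed auto
  show ?thesis using f
  proof (induction rule: gen.induct)
    case (gen_step s f)
    then obtain \<tau> \<delta> where f: "\<tau> \<in> gen T" "\<delta> \<in> gen D" "f = \<tau> \<circ> \<delta>" by blast
    obtain \<tau>' \<delta>' where s: "\<tau>' \<in> gen T" "\<delta>' \<in> gen D" "s = \<tau>' \<circ> \<delta>'" using S[OF gen_step.hyps(1)] by blast
    obtain \<sigma> where "\<sigma> \<in> gen T" "\<delta>' \<circ> \<tau> = \<sigma> \<circ> \<delta>'" using conj2[OF s(2) f(1)] by blast
    then have "s \<circ> f = (\<tau>' \<circ> \<sigma>) \<circ> (\<delta>' \<circ> \<delta>)" using f s by (metis comp_assoc)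
    then show ?case using f s \<open>\<sigma> \<in> gen T\<close> gen_comp by blast
  next
  case gen_id
  show ?case by (intro bexI[of _ id] gen.gen_id) simp_all
qed
qed

lemma funpow_id_if_finite:
  assumes f: "f \<in> gen S" and fin: "finite (gen S)" and invol: "\<And>s. s \<in> S \<Longrightarrow> s \<circ> s = id"
  shows "\<exists>M\<ge>1. f ^^ M = id"
proof -
  have "\<exists>M\<ge>1. f ^^ M \<in> gen {}"
  proof (rule power_in_finite_index[OF f _ fin invol])
    show "\<exists>\<tau>\<in>gen {}. \<exists>\<delta>\<in>gen S. g = \<tau> \<circ> \<delta>" if "g \<in> gen S" for g
      by (intro bexI[of _ id] bexI[of _ g]) (simp_all add: gen_id that)
  qed simp_all
  moreover have "g = id" if "g \<in> gen {}" for g :: "'a \<Rightarrow> 'a" using that by (induction rule: gen.induct) auto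
  ultimately show ?thesis by blast
qed

text \<open>Here \<open>u\<close> represents the nontrivial coset of a subgroup of index at most two.\<close>

lemma square_in_index_two:
  assumes f: "f \<in> gen S" and u: "u \<circ> u = id" and S: "S \<subseteq> insert u T"
    and conj: "\<And>\<tau>. \<tau> \<in> T \<Longrightarrow> \<exists>\<sigma>\<in>gen T. u \<circ> \<tau> = \<sigma> \<circ> u"
  shows "f \<circ> f \<in> gen T"
proof -
  have "\<exists>\<tau>\<in>gen T. \<exists>\<delta>\<in>gen {u}. f = \<tau> \<circ> \<delta>"
  proof (rule semidirect_factorization[OF f])
    show "\<exists>\<tau>\<in>gen T. \<exists>\<delta>\<in>gen {u}. s = \<tau> \<circ> \<delta>" if "s \<in> S" for s
    proof (cases "s = u")
      case True
      then show ?thesis by (intro bexI[of _ id] bexI[of _ u]) (simp_all add: gen_id gen_base)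
    next
      case False
      then have "s \<in> T" using that S by blast
      then show ?thesis by (intro bexI[of _ s] bexI[of _ id]) (simp_all add: gen_id gen_base)
    qed
  qed (use conj in blast)
  then obtain \<tau> \<delta> where f: "\<tau> \<in> gen T" "\<delta> \<in> gen {u}" "f = \<tau> \<circ> \<delta>" by blast
  have "\<delta> = id \<or> \<delta> = u" using f(2)
  proof (induction rule: gen.induct)
    case (gen_step s \<delta>)
    then show ?case using u by (metis comp_id singletonD)
  qed simp
  then show ?thesis
  proof
    assume "\<delta> = id"
    then show ?thesis using f gen_comp by simp
  next
    assume \<delta>: "\<delta> = u"
    obtain \<sigma> where \<sigma>: "\<sigma> \<in> gen T" "u \<circ> \<tau> = \<sigma> \<circ> u" using gen_conj[OF f(1) conj] by blast
    have "f \<circ> f = \<tau> \<circ> (u \<circ> \<tau>) \<circ> u" by (simp add: f \<delta> comp_assoc)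
    also have "\<dots> = (\<tau> \<circ> \<sigma>) \<circ> (u \<circ> u)" unfolding \<sigma>(2) by (simp only: comp_assoc)
    finally show ?thesis using u gen_comp[OF f(1) \<sigma>(1)] by simp
  qed
qed

section \<open>Spherical triangle groups are finite\<close>

text \<open>For involutions, the relation \<open>(ab)^k = 1\<close> is the equality of the two alternating words of
length \<open>k\<close>. In this form it is a length-preserving rewrite rule.\<close>

lemma braid_relations:
  fixes a b :: "'x \<Rightarrow> 'x"
  assumes aa: "\<And>x. a (a x) = x" and bb: "\<And>x. b (b x) = x"
  shows "(a \<circ> b) ^^ 2 = id \<Longrightarrow> a (b x) = b (a x)"
    and "(a \<circ> b) ^^ 3 = id \<Longrightarrow> a (b (a x)) = b (a (b x))"
    and "(a \<circ> b) ^^ 4 = id \<Longrightarrow> a (b (a (b x))) = b (a (b (a x)))"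
    and "(a \<circ> b) ^^ 5 = id \<Longrightarrow> a (b (a (b (a x)))) = b (a (b (a (b x))))"
proof -
  show "a (b x) = b (a x)" if "(a \<circ> b) ^^ 2 = id"
    using fun_cong[OF that, of "b (a x)"] by (simp add: aa bb numeral_eq_Suc)
  show "a (b (a x)) = b (a (b x))" if "(a \<circ> b) ^^ 3 = id"
    using fun_cong[OF that, of "b (a (b x))"] by (simp add: aa bb numeral_eq_Suc)
  show "a (b (a (b x))) = b (a (b (a x)))" if "(a \<circ> b) ^^ 4 = id"
    using fun_cong[OF that, of "b (a (b (a x)))"] by (simp add: aa bb numeral_eq_Suc)
  show "a (b (a (b (a x)))) = b (a (b (a (b x))))" if "(a \<circ> b) ^^ 5 = id"
    using fun_cong[OF that, of "b (a (b (a (b x))))"] by (simp add: aa bb numeral_eq_Suc)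
qed

lemma finite_gen_prism:
  assumes "\<And>x. a (a x) = x" "\<And>x. b (b x) = x" "\<And>x. c (c x) = x"
    and ab: "\<And>x. a (b x) = b (a x)" and bc: "\<And>x. b (c x) = c (b x)" and D: "finite (gen {a, c})"
  shows "finite (gen {a, b, c})"
proof (rule finite_gen_if_finite_index[OF D, of "{id, b}"])
  fix v s assume "v \<in> {id, b}" "s \<in> {a, b, c}"
  then consider "v = id" "s \<noteq> b" "s \<in> {a, c}" | "v = id" "s = b" | "v = b" "s = b" | "v = b" "s \<in> {a, c}" by blast
  then show "\<exists>u\<in>gen {a, c}. \<exists>v'\<in>{id, b}. v \<circ> s = u \<circ> v'"
  proof cases
    case 1 then show ?thesis by (intro bexI[of _ s] bexI[of _ id]) (simp_all add: gen_base)
  next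
    case 2 then show ?thesis by (intro bexI[of _ id] bexI[of _ b]) (simp_all add: gen_id)
  next
    case 3 then show ?thesis using assms(2) by (intro bexI[of _ id] bexI[of _ id]) (auto simp: gen_id fun_eq_iff)
  next
    case 4 then show ?thesis by (intro bexI[of _ s] bexI[of _ b]) (auto simp: gen_base fun_eq_iff ab bc)
  qed
qed simp_all

text \<open>The listed elements represent the four cosets of \<open>\<langle>a,b\<rangle>\<close>, the vertices of a tetrahedron. The rewrite
rule \<open>cbac\<close> resolves the overlap of \<open>cbc\<close> with \<open>ca\<close>.\<close>

lemma finite_gen_tetrahedral:
  assumes inv: "\<And>x. a (a x) = x" "\<And>x. b (b x) = x" "\<And>x. c (c x) = x"
    and ac: "\<And>x. c (a x) = a (c x)" and bc: "\<And>x. c (b (c x)) = b (c (b x))"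
    and ab: "\<And>x. b (a (b x)) = a (b (a x))" and D: "finite (gen {a, b})"
  shows "finite (gen {a, b, c})"
proof (rule finite_gen_if_finite_index[OF D, of "{id, c, c \<circ> b, c \<circ> b \<circ> a}"])
  have cbac: "c (b (a (c x))) = b (c (b (a x)))" for x
    using bc[of "a x"] by (simp add: ac)
  fix v s assume v: "v \<in> {id, c, c \<circ> b, c \<circ> b \<circ> a}" and s: "s \<in> {a, b, c}"
  have "\<exists>u\<in>{id, a, b}. \<exists>v'\<in>{id, c, c \<circ> b, c \<circ> b \<circ> a}. \<forall>x. v (s x) = u (v' x)"
    using v s by (elim insertE emptyE) (simp_all add: inv ac bc ab cbac)
  then obtain u v' where "u \<in> {id, a, b}" "v' \<in> {id, c, c \<circ> b, c \<circ> b \<circ> a}" "v \<circ> s = u \<circ> v'"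
    by (auto simp only: fun_eq_iff comp_apply)
  moreover have "{id, a, b} \<subseteq> gen {a, b}" by (simp add: gen_id gen_base)
  ultimately show "\<exists>u\<in>gen {a, b}. \<exists>v'\<in>{id, c, c \<circ> b, c \<circ> b \<circ> a}. v \<circ> s = u \<circ> v'" by blast
qed simp_all

text \<open>The twelve elements of \<open>V\<close> represent the cosets of \<open>\<langle>a,b\<rangle>\<close>, the vertices of an icosahedron. Three derived
rules complete the braid relations to a rewrite system that is strong enough to verify all entries
of the coset table.\<close>

lemma finite_gen_icosahedral:
  assumes inv: "\<And>x. a (a x) = x" "\<And>x. b (b x) = x" "\<And>x. c (c x) = x"
    and ac: "\<And>x. c (a x) = a (c x)" and bc: "\<And>x. c (b (c x)) = b (c (b x))"
    and ab: "\<And>x. b (a (b (a (b x)))) = a (b (a (b (a x))))" and D: "finite (gen {a, b})"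
  shows "finite (gen {a, b, c})"
proof -
  have cbac: "c (b (a (c x))) = b (c (b (a x)))" for x
    using bc[of "a x"] by (simp add: ac)
  have cbabcb: "c (b (a (b (c (b x))))) = b (c (b (a (b (c x)))))" for x
  proof -
    have "c (b (a (b (c (b x))))) = c (b (a (c (b (c x)))))" by (simp only: bc)
    also have "\<dots> = b (c (b (a (b (c x)))))" by (rule cbac)
    finally show ?thesis .
  qed
  have long: "c (b (a (b (a (c (b (a (b (a x))))))))) = b (c (b (a (b (a (c (b (a (b x)))))))))" for x
  proof -
    have "c (b (a (b (a (c (b (a (b (a x))))))))) = c (b (a (b (c (a (b (a (b (a x)))))))))" by (simp only: ac)
    also have "\<dots> = c (b (a (b (c (b (a (b (a (b x)))))))))" by (simp only: ab)
    also have "\<dots> = b (c (b (a (b (c (a (b (a (b x)))))))))" by (simp only: cbabcb)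
    finally show ?thesis by (simp only: ac)
  qed
  define V where "V = {id, c, c \<circ> b, c \<circ> b \<circ> a, c \<circ> b \<circ> a \<circ> b, c \<circ> b \<circ> a \<circ> b \<circ> a, c \<circ> b \<circ> a \<circ> b \<circ> c,
    c \<circ> b \<circ> a \<circ> b \<circ> a \<circ> c, c \<circ> b \<circ> a \<circ> b \<circ> a \<circ> c \<circ> b, c \<circ> b \<circ> a \<circ> b \<circ> a \<circ> c \<circ> b \<circ> a,
    c \<circ> b \<circ> a \<circ> b \<circ> a \<circ> c \<circ> b \<circ> a \<circ> b, c \<circ> b \<circ> a \<circ> b \<circ> a \<circ> c \<circ> b \<circ> a \<circ> b \<circ> c}"
  show ?thesis
  proof (rule finite_gen_if_finite_index[OF D, of V])
    fix v s assume v: "v \<in> V" and s: "s \<in> {a, b, c}"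
    have "\<exists>u\<in>{id, a, b}. \<exists>v'\<in>V. \<forall>x. v (s x) = u (v' x)"
      using v s unfolding V_def by (elim insertE emptyE) (simp_all add: inv ac bc ab cbac cbabcb long)
    then obtain u v' where "u \<in> {id, a, b}" "v' \<in> V" "v \<circ> s = u \<circ> v'"
      by (auto simp only: fun_eq_iff comp_apply)
    moreover have "{id, a, b} \<subseteq> gen {a, b}" by (simp add: gen_id gen_base)
    ultimately show "\<exists>u\<in>gen {a, b}. \<exists>v'\<in>V. v \<circ> s = u \<circ> v'" by blast
  qed (simp_all add: V_def)
qed


section \<open>Triangle groups that are not hyperbolic have no loxodromic elements\<close>

context four_point_space begin

text \<open>Powers are allowed because only elements of a subgroup of finite index are shown to be slow.\<close>

definition tame :: "('x \<Rightarrow> 'x) set \<Rightarrow> bool" where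
  "tame S \<longleftrightarrow> (\<forall>f\<in>gen S. \<exists>M\<ge>1. slow (f ^^ M))"

lemma tame_if_finite:
  assumes "finite (gen S)" and "\<And>s. s \<in> S \<Longrightarrow> s \<circ> s = id" shows "tame S"
  unfolding tame_def
proof
  fix f assume "f \<in> gen S"
  then obtain M where "M \<ge> 1" "f ^^ M = id" using funpow_id_if_finite assms by blast
  then show "\<exists>M\<ge>1. slow (f ^^ M)" using slow_id by (intro exI[of _ M]) simp
qed

lemma tame_if_index_two:
  assumes T: "tame T" and u: "u \<circ> u = id" and S: "S \<subseteq> insert u T"
    and conj: "\<And>\<tau>. \<tau> \<in> T \<Longrightarrow> \<exists>\<sigma>\<in>gen T. u \<circ> \<tau> = \<sigma> \<circ> u"
  shows "tame S"
  unfolding tame_def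
proof
  fix f assume "f \<in> gen S"
  then have "f \<circ> f \<in> gen T" using square_in_index_two[OF _ u S conj] by blast
  then obtain M where M: "M \<ge> 1" "slow ((f \<circ> f) ^^ M)" using T by (auto simp: tame_def)
  have "f \<circ> f = f ^^ 2" by (simp add: numeral_2_eq_2)
  then have "slow (f ^^ (2 * M))" using M(2) by (simp only: funpow_mult)
  then show "\<exists>M\<ge>1. slow (f ^^ M)" using M(1) by (intro exI[of _ "2 * M"]) simp
qed

lemma isom_gen: "f \<in> gen S \<Longrightarrow> (\<And>s. s \<in> S \<Longrightarrow> isom s) \<Longrightarrow> isom f"
  by (induction rule: gen.induct) (auto intro: isom_comp isom_id)

lemma slow_gen_commuting:
  assumes f: "f \<in> gen T" and T: "\<And>s. s \<in> T \<Longrightarrow> isom s \<and> slow s"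
    and comm: "\<And>s s'. s \<in> T \<Longrightarrow> s' \<in> T \<Longrightarrow> s \<circ> s' = s' \<circ> s"
  shows "slow f"
  using f
proof (induction rule: gen.induct)
  case (gen_step s f)
  have "s \<circ> f = f \<circ> s" using gen_step.hyps(2)
  proof (induction rule: gen.induct)
    case (gen_step s' f)
    then show ?case using comm[OF \<open>s \<in> T\<close> gen_step.hyps(1)] by (metis comp_assoc)
  qed simp
  moreover have "isom f" using isom_gen[OF gen_step.hyps(2)] T by blast
  ultimately show ?case using T gen_step by (intro slow_comp) auto
qed (rule slow_id)

text \<open>The commuting \<open>t\<close> and \<open>u\<close> with their inverses \<open>ti\<close> and \<open>ui\<close> generate the translations, \<open>D\<close> generates the
finite point group, and \<open>\<rho>\<close> is the linear part of \<open>a\<close>.\<close>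

lemma tame_if_translation_lattice:
  assumes isom: "isom t" "isom ti" "isom u" "isom ui"
    and inv: "t \<circ> ti = id" "ti \<circ> t = id" "u \<circ> ui = id" "ui \<circ> u = id"
    and comm: "t \<circ> u = u \<circ> t" and close: "close t u"
    and rot: "close (t \<circ> u) t \<or> close (t \<circ> u) (ti \<circ> u)"
    and D: "finite (gen D)" "\<And>s. s \<in> D \<Longrightarrow> s \<circ> s = id"
    and conj: "\<And>s \<tau>. s \<in> D \<Longrightarrow> \<tau> \<in> {t, ti, u, ui} \<Longrightarrow> \<exists>\<sigma>\<in>gen {t, ti, u, ui}. s \<circ> \<tau> = \<sigma> \<circ> s"
    and a: "a = t \<circ> \<rho>" "\<rho> \<in> gen D"
  shows "tame (insert a D)"
  unfolding tame_def
proof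
  define T where "T = {t, ti, u, ui}"
  have "slow t" by (rule slow_if_rotated[OF isom(1,3) comm isom(2) inv(1,2) close rot])
  moreover have "slow u" using slow_close[OF \<open>slow t\<close> close] .
  ultimately have slow: "slow s" if "s \<in> T" for s
    using that slow_close close_inverse[OF isom(1,2) inv(1)] close_inverse[OF isom(3,4) inv(3)]
    unfolding T_def by blast
  have inverse_commutes: "g \<circ> h = h \<circ> g" if "f \<circ> h = h \<circ> f" "f \<circ> g = id" "g \<circ> f = id" for f g h :: "'x \<Rightarrow> 'x"
  proof -
    have "g \<circ> h = g \<circ> (h \<circ> f) \<circ> g" using that by (simp add: comp_assoc)
    also have "\<dots> = (g \<circ> f) \<circ> (h \<circ> g)" by (simp only: comp_assoc flip: that(1))
    finally show ?thesis using that by simp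
  qed
  have 1: "ti \<circ> u = u \<circ> ti" using inverse_commutes[OF comm inv(1,2)] .
  have 2: "ui \<circ> t = t \<circ> ui" using inverse_commutes[OF comm[symmetric] inv(3,4)] .
  have 3: "ui \<circ> ti = ti \<circ> ui" using inverse_commutes[OF 1[symmetric] inv(3,4)] .
  have commT: "s \<circ> s' = s' \<circ> s" if "s \<in> T" "s' \<in> T" for s s'
    using that comm 1 2 3 inv unfolding T_def by (elim insertE emptyE) simp_all
  fix f assume f: "f \<in> gen (insert a D)"
  have "\<exists>M\<ge>1. f ^^ M \<in> gen T"
  proof (rule power_in_finite_index[OF f _ D])
    show "\<exists>s'\<in>T. s \<circ> s' = id" if "s \<in> T" for s using that inv unfolding T_def by blast
    show "\<exists>\<tau>\<in>gen T. \<exists>\<delta>\<in>gen D. g = \<tau> \<circ> \<delta>" if "g \<in> gen (insert a D)" for g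
    proof (rule semidirect_factorization[OF that])
      show "\<exists>\<sigma>\<in>gen T. s \<circ> \<tau> = \<sigma> \<circ> s" if "s \<in> D" "\<tau> \<in> T" for s \<tau>
        using conj that unfolding T_def by blast
      show "\<exists>\<tau>\<in>gen T. \<exists>\<delta>\<in>gen D. s = \<tau> \<circ> \<delta>" if "s \<in> insert a D" for s
      proof (cases "s = a")
        case True
        then show ?thesis using a by (intro bexI[of _ t] bexI[of _ \<rho>]) (simp_all add: T_def gen_base)
      next
        case False
        then show ?thesis using that by (intro bexI[of _ id] bexI[of _ s]) (simp_all add: gen_id gen_base)
      qed
    qed
  qed
  then obtain M where "M \<ge> 1" "f ^^ M \<in> gen T" by blast
  moreover have "isom s" if "s \<in> T" for s using that isom by (auto simp: T_def)
  ultimately show "\<exists>M\<ge>1. slow (f ^^ M)" using slow_gen_commuting slow commT by blast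
qed

text \<open>The linear part of the reflection \<open>a\<close> is the reflection \<open>bcb\<close>, whose mirror passes through the common
fixed point of \<open>b\<close> and \<open>c\<close> parallel to that of \<open>a\<close>. The rotation \<open>bc\<close> of order 3 takes \<open>t\<close> to \<open>u\<close> and its square
takes \<open>t\<close> to the inverse of \<open>tu\<close>.\<close>

lemma tame_triangular_lattice:
  assumes isom: "isom a" "isom b" "isom c"
    and inv: "\<And>x. a (a x) = x" "\<And>x. b (b x) = x" "\<And>x. c (c x) = x"
    and ab: "\<And>x. b (a (b x)) = a (b (a x))" and bc: "\<And>x. c (b (c x)) = b (c (b x))"
    and ac: "\<And>x. c (a (c x)) = a (c (a x))" and D: "finite (gen {b, c})"
  shows "tame {a, b, c}"
proof -
  define t where "t = a \<circ> b \<circ> c \<circ> b"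
  define ti where "ti = b \<circ> c \<circ> b \<circ> a"
  define u where "u = b \<circ> c \<circ> a \<circ> c"
  define ui where "ui = c \<circ> a \<circ> c \<circ> b"
  note defs = t_def ti_def u_def ui_def
  \<comment> \<open>The overlap of \<open>cbc\<close> with \<open>cac\<close>, needed to make the rewriting below succeed.\<close>
  have cbaca: "c (b (a (c (a x)))) = b (c (b (a (c x))))" for x
    using bc[of "a (c x)"] by (simp only: ac)
  note rules = inv ab bc ac cbaca
  have iso: "isom t" "isom ti" "isom u" "isom ui" unfolding defs by (intro isom_comp isom)+
  have inverse: "t \<circ> ti = id" "ti \<circ> t = id" "u \<circ> ui = id" "ui \<circ> u = id"
    by (simp_all add: fun_eq_iff defs inv)
  have conj: "b \<circ> t = (t \<circ> u) \<circ> b" "b \<circ> ti = (ui \<circ> ti) \<circ> b" "b \<circ> u = ui \<circ> b" "b \<circ> ui = u \<circ> b"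
    "c \<circ> t = ui \<circ> c" "c \<circ> ti = u \<circ> c" "c \<circ> u = ti \<circ> c" "c \<circ> ui = t \<circ> c"
    by (simp_all add: fun_eq_iff defs rules)
  show ?thesis
  proof (rule tame_if_translation_lattice[OF iso inverse _ _ _ D])
    show "t \<circ> u = u \<circ> t" by (simp add: fun_eq_iff defs rules)
    show "close t u"
      by (rule close_conj[OF isom_comp[OF isom(2,3)] iso(1,3)]) (simp add: fun_eq_iff defs rules)
    \<comment> \<open>Conjugation by \<open>cb\<close>, the inverse of the rotation, takes the inverse of \<open>t\<close> to \<open>tu\<close>.\<close>
    have "close ti (t \<circ> u)"
      by (rule close_conj[OF isom_comp[OF isom(3,2)] iso(2) isom_comp[OF iso(1,3)]])
        (simp add: fun_eq_iff defs rules)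
    then have "close (t \<circ> u) t"
      using close_trans[OF close_sym close_sym] close_inverse[OF iso(1,2) inverse(1)] by blast
    then show "close (t \<circ> u) t \<or> close (t \<circ> u) (ti \<circ> u)" ..
    show "s \<circ> s = id" if "s \<in> {b, c}" for s using that inv by (auto simp: fun_eq_iff)
    show "b \<circ> c \<circ> b \<in> gen {b, c}" by (intro gen_comp gen_base) auto
    show "a = t \<circ> (b \<circ> c \<circ> b)" by (simp add: fun_eq_iff t_def inv)
    have "{t, ti, u, ui, t \<circ> u, ui \<circ> ti} \<subseteq> gen {t, ti, u, ui}"
      by (simp add: gen_base gen_comp)
    then show "\<exists>\<sigma>\<in>gen {t, ti, u, ui}. s \<circ> \<tau> = \<sigma> \<circ> s" if "s \<in> {b, c}" "\<tau> \<in> {t, ti, u, ui}" for s \<tau>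
      using that conj by blast
  qed
qed

text \<open>The linear part of \<open>q\<close> is \<open>hph\<close>. The rotation \<open>hp\<close> of order 4 takes \<open>t\<close> to \<open>u\<close> and \<open>u\<close> to the inverse of \<open>t\<close>, hence
\<open>tu\<close> to the product of \<open>u\<close> with the inverse of \<open>t\<close>.\<close>

lemma tame_square_lattice:
  assumes isom: "isom p" "isom q" "isom h"
    and inv: "\<And>x. p (p x) = x" "\<And>x. q (q x) = x" "\<And>x. h (h x) = x"
    and pq: "\<And>x. p (q x) = q (p x)" and ph: "\<And>x. h (p (h (p x))) = p (h (p (h x)))"
    and qh: "\<And>x. h (q (h (q x))) = q (h (q (h x)))" and D: "finite (gen {h, p})"
  shows "tame {q, h, p}"
proof -
  define t where "t = q \<circ> h \<circ> p \<circ> h"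
  define ti where "ti = h \<circ> p \<circ> h \<circ> q"
  define u where "u = h \<circ> q \<circ> h \<circ> p"
  define ui where "ui = p \<circ> h \<circ> q \<circ> h"
  note defs = t_def ti_def u_def ui_def
  \<comment> \<open>The overlap of \<open>hphp\<close> with \<open>pq\<close>, needed to make the rewriting below succeed.\<close>
  have hphqp: "h (p (h (q (p x)))) = p (h (p (h (q x))))" for x
    using ph[of "q x"] by (simp only: pq)
  note rules = inv pq ph qh hphqp
  have iso: "isom t" "isom ti" "isom u" "isom ui" unfolding defs by (intro isom_comp isom)+
  have inverse: "t \<circ> ti = id" "ti \<circ> t = id" "u \<circ> ui = id" "ui \<circ> u = id"
    by (simp_all add: fun_eq_iff defs inv)
  have conj: "p \<circ> t = t \<circ> p" "p \<circ> ti = ti \<circ> p" "p \<circ> u = ui \<circ> p" "p \<circ> ui = u \<circ> p"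
    "h \<circ> t = u \<circ> h" "h \<circ> ti = ui \<circ> h" "h \<circ> u = t \<circ> h" "h \<circ> ui = ti \<circ> h"
    by (simp_all add: fun_eq_iff defs rules)
  have comm: "t \<circ> u = u \<circ> t" by (simp add: fun_eq_iff defs rules)
  show ?thesis
  proof (rule tame_if_translation_lattice[OF iso inverse comm _ _ D])
    show "close t u" by (rule close_conj[OF isom(3) iso(1,3) conj(5)])
    have "(h \<circ> p) \<circ> (t \<circ> u) = (u \<circ> ti) \<circ> (h \<circ> p)" using conj by (metis comp_assoc)
    then have "close (t \<circ> u) (u \<circ> ti)"
      by (rule close_conj[OF isom_comp[OF isom(3,1)] isom_comp[OF iso(1,3)] isom_comp[OF iso(3,2)]])
    moreover have "u \<circ> ti = ti \<circ> u"
    proof -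
      have "u \<circ> ti = (ti \<circ> t) \<circ> (u \<circ> ti)" using inverse by simp
      also have "\<dots> = ti \<circ> (u \<circ> t) \<circ> ti" by (simp only: comp_assoc flip: comm)
      also have "\<dots> = ti \<circ> u \<circ> (t \<circ> ti)" by (simp only: comp_assoc)
      finally show ?thesis using inverse by simp
    qed
    ultimately show "close (t \<circ> u) t \<or> close (t \<circ> u) (ti \<circ> u)" by simp
    show "s \<circ> s = id" if "s \<in> {h, p}" for s using that inv by (auto simp: fun_eq_iff)
    show "h \<circ> p \<circ> h \<in> gen {h, p}" by (intro gen_comp gen_base) auto
    show "q = t \<circ> (h \<circ> p \<circ> h)" by (simp add: fun_eq_iff t_def inv)
    have "{t, ti, u, ui} \<subseteq> gen {t, ti, u, ui}" by (simp add: gen_base)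
    then show "\<exists>\<sigma>\<in>gen {t, ti, u, ui}. s \<circ> \<tau> = \<sigma> \<circ> s" if "s \<in> {h, p}" "\<tau> \<in> {t, ti, u, ui}" for s \<tau>
      using that conj by blast
  qed
qed

definition triangle_isoms :: "('x \<Rightarrow> 'x) \<Rightarrow> ('x \<Rightarrow> 'x) \<Rightarrow> ('x \<Rightarrow> 'x) \<Rightarrow> nat \<Rightarrow> nat \<Rightarrow> nat \<Rightarrow> bool" where
  "triangle_isoms a b c l m n \<longleftrightarrow> isom a \<and> isom b \<and> isom c \<and> a \<circ> a = id \<and> b \<circ> b = id \<and> c \<circ> c = id \<and>
     (a \<circ> b) ^^ l = id \<and> (b \<circ> c) ^^ m = id \<and> (a \<circ> c) ^^ n = id"

lemma funpow_comp_swap: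
  fixes a b :: "'b \<Rightarrow> 'b"
  assumes "b \<circ> b = id" "(a \<circ> b) ^^ k = id" shows "(b \<circ> a) ^^ k = id"
proof -
  have "b \<circ> (a \<circ> b) ^^ k = (b \<circ> a) ^^ k \<circ> b" by (rule comp_funpow_conj) (simp only: comp_assoc)
  then have "b \<circ> b = (b \<circ> a) ^^ k \<circ> (b \<circ> b)" using assms(2) by (metis comp_assoc comp_id)
  then show ?thesis using assms(1) by simp
qed

text \<open>These two transpositions of the generators induce all permutations of the labels.\<close>

lemma triangle_isoms_swap:
  assumes "triangle_isoms a b c l m n"
  shows "triangle_isoms c b a m l n" "triangle_isoms b a c l n m"
  using assms funpow_comp_swap unfolding triangle_isoms_def by blast+

lemma triangle_isomsD:
  assumes "triangle_isoms a b c l m n"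
  shows "isom a" "isom b" "isom c" "a (a x) = x" "b (b x) = x" "c (c x) = x"
    "l \<ge> 1 \<Longrightarrow> finite (gen {a, b})" "m \<ge> 1 \<Longrightarrow> finite (gen {b, c})" "n \<ge> 1 \<Longrightarrow> finite (gen {a, c})"
    "s \<in> {a, b, c} \<Longrightarrow> s \<circ> s = id"
  using assms finite_gen_dihedral unfolding triangle_isoms_def by (auto simp: fun_eq_iff)

lemma tame_22n:
  assumes R: "triangle_isoms a b c 2 2 n" and n: "n \<ge> 1"
  shows "tame {a, b, c}"
proof (rule tame_if_finite)
  note D = triangle_isomsD[OF R]
  have rel: "(a \<circ> b) ^^ 2 = id" "(b \<circ> c) ^^ 2 = id" using R by (auto simp: triangle_isoms_def)
  have comm: "a (b x) = b (a x)" "b (c x) = c (b x)" for x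
    using braid_relations(1)[of a b, OF D(4,5) rel(1)] braid_relations(1)[of b c, OF D(5,6) rel(2)] by simp_all
  show "finite (gen {a, b, c})" by (rule finite_gen_prism[of a b c, OF D(4,5,6) comm D(9)[OF n]])
qed (use triangle_isomsD[OF R] in blast)

lemma tame_233:
  assumes R: "triangle_isoms a b c 2 3 3"
  shows "tame {a, b, c}"
proof (rule tame_if_finite)
  note D = triangle_isomsD[OF R]
  have rel: "(a \<circ> b) ^^ 2 = id" "(b \<circ> c) ^^ 3 = id" "(a \<circ> c) ^^ 3 = id" using R by (auto simp: triangle_isoms_def)
  have "finite (gen {a, c, b})"
    by (rule finite_gen_tetrahedral[OF D(4,6,5)])
      (use braid_relations[OF D(4,5)] braid_relations[OF D(5,6)] braid_relations[OF D(4,6)] rel D(9) in simp_all)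
  then show "finite (gen {a, b, c})" by (simp add: insert_commute)
qed (use triangle_isomsD[OF R] in blast)

lemma tame_235:
  assumes R: "triangle_isoms a b c 2 3 5"
  shows "tame {a, b, c}"
proof (rule tame_if_finite)
  note D = triangle_isomsD[OF R]
  have rel: "(a \<circ> b) ^^ 2 = id" "(b \<circ> c) ^^ 3 = id" "(a \<circ> c) ^^ 5 = id" using R by (auto simp: triangle_isoms_def)
  have "finite (gen {a, c, b})"
    by (rule finite_gen_icosahedral[OF D(4,6,5)])
      (use braid_relations[OF D(4,5)] braid_relations[OF D(5,6)] braid_relations[OF D(4,6)] rel D(9) in simp_all)
  then show "finite (gen {a, b, c})" by (simp add: insert_commute)
qed (use triangle_isomsD[OF R] in blast)

lemma tame_333:
  assumes R: "triangle_isoms a b c 3 3 3"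
  shows "tame {a, b, c}"
proof (rule tame_triangular_lattice)
  note D = triangle_isomsD[OF R]
  have rel: "(a \<circ> b) ^^ 3 = id" "(b \<circ> c) ^^ 3 = id" "(a \<circ> c) ^^ 3 = id" using R by (auto simp: triangle_isoms_def)
  show "b (a (b x)) = a (b (a x))" "c (b (c x)) = b (c (b x))" "c (a (c x)) = a (c (a x))" for x
    using braid_relations(2)[OF D(4,5)] braid_relations(2)[OF D(5,6)] braid_relations(2)[OF D(4,6)] rel by simp_all
qed (use triangle_isomsD[OF R] in simp_all)

lemma tame_244:
  assumes R: "triangle_isoms a b c 2 4 4"
  shows "tame {a, b, c}"
proof -
  note D = triangle_isomsD[OF R]
  have rel: "(a \<circ> b) ^^ 2 = id" "(b \<circ> c) ^^ 4 = id" "(a \<circ> c) ^^ 4 = id" using R by (auto simp: triangle_isoms_def)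
  have "tame {b, c, a}"
  proof (rule tame_square_lattice[OF D(1,2,3,4,5,6)])
    show "a (b x) = b (a x)" "c (a (c (a x))) = a (c (a (c x)))" "c (b (c (b x))) = b (c (b (c x)))" for x
      using braid_relations(1)[OF D(4,5)] braid_relations(3)[OF D(5,6)] braid_relations(3)[OF D(4,6)] rel by simp_all
    show "finite (gen {c, a})" using D(9) by (simp add: insert_commute)
  qed
  then show ?thesis by (simp add: insert_commute)
qed

text \<open>The subgroup generated by \<open>c\<close>, \<open>b\<close> and \<open>aca\<close> is normalised by \<open>a\<close>: halving the triangle with angles
\<open>\<pi>/j\<close>, \<open>\<pi>/3\<close>, \<open>\<pi>/3\<close> along its axis of symmetry, the mirror of \<open>a\<close>, gives the one with angles
\<open>\<pi>/2\<close>, \<open>\<pi>/3\<close>, \<open>\<pi>/(2 * j)\<close>.\<close>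

lemma tame_index_two:
  assumes R: "triangle_isoms a b c 2 3 (2 * j)"
    and sub: "\<And>a b c. triangle_isoms a b c j 3 3 \<Longrightarrow> tame {a, b, c}"
  shows "tame {a, b, c}"
proof (rule tame_if_index_two[of "{a \<circ> c \<circ> a, c, b}" a])
  note D = triangle_isomsD[OF R]
  have rel: "(a \<circ> b) ^^ 2 = id" "(b \<circ> c) ^^ 3 = id" "(a \<circ> c) ^^ (2 * j) = id" using R by (auto simp: triangle_isoms_def)
  have ab: "a (b x) = b (a x)" for x using braid_relations(1)[OF D(4,5) rel(1)] .
  show aa: "a \<circ> a = id" using D(10) by blast
  have "(a \<circ> c \<circ> a) \<circ> c = (a \<circ> c) ^^ 2" by (simp add: fun_eq_iff numeral_2_eq_2)
  then have 1: "((a \<circ> c \<circ> a) \<circ> c) ^^ j = id" using rel(3) by (simp only: funpow_mult)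
  have 2: "(c \<circ> b) ^^ 3 = id" using funpow_comp_swap[OF _ rel(2)] D(10) by blast
  have "a \<circ> (c \<circ> b) ^^ 3 = ((a \<circ> c \<circ> a) \<circ> b) ^^ 3 \<circ> a"
    by (rule comp_funpow_conj) (simp add: fun_eq_iff ab D(4))
  then have "a \<circ> a = ((a \<circ> c \<circ> a) \<circ> b) ^^ 3 \<circ> (a \<circ> a)" unfolding 2 by (metis comp_assoc comp_id)
  then have 3: "((a \<circ> c \<circ> a) \<circ> b) ^^ 3 = id" using aa by simp
  have "isom (a \<circ> c \<circ> a)" by (intro isom_comp D)
  moreover have "(a \<circ> c \<circ> a) \<circ> (a \<circ> c \<circ> a) = id" by (simp add: fun_eq_iff D)
  ultimately show "tame {a \<circ> c \<circ> a, c, b}"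
    using 1 2 3 R by (intro sub) (simp add: triangle_isoms_def)
  show "{a, b, c} \<subseteq> insert a {a \<circ> c \<circ> a, c, b}" by blast
  fix \<tau> assume "\<tau> \<in> {a \<circ> c \<circ> a, c, b}"
  moreover have "a \<circ> (a \<circ> c \<circ> a) = c \<circ> a" "a \<circ> c = (a \<circ> c \<circ> a) \<circ> a" "a \<circ> b = b \<circ> a"
    by (simp_all add: fun_eq_iff D ab)
  ultimately obtain \<sigma> where "\<sigma> \<in> {a \<circ> c \<circ> a, c, b}" "a \<circ> \<tau> = \<sigma> \<circ> a" by blast
  then show "\<exists>\<sigma>\<in>gen {a \<circ> c \<circ> a, c, b}. a \<circ> \<tau> = \<sigma> \<circ> a"
    using gen_base[of \<sigma> "{a \<circ> c \<circ> a, c, b}"] by (intro bexI[of _ \<sigma>])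
qed

text \<open>The inequality is \<open>1/l + 1/m + 1/n \<ge> 1\<close> without denominators.\<close>

lemma nonhyperbolic_sorted:
  assumes "2 \<le> l" "l \<le> m" "m \<le> n" and ge: "l * m * n \<le> m * n + l * n + l * (m::nat)"
  shows "l = 2 \<and> m = 2 \<or> l = 2 \<and> m = 3 \<and> n \<in> {3, 4, 5, 6} \<or> l = 2 \<and> m = 4 \<and> n = 4 \<or> l = 3 \<and> m = 3 \<and> n = 3"
proof -
  have pos: "0 < n" "0 < m" using assms by auto
  have "l * n \<le> m * n" "l * m \<le> m * n" using assms(2,3) by (simp_all add: mult.commute mult_le_mono)
  then have "l * (m * n) \<le> 3 * (m * n)" using ge mult.assoc[of l m n] by linarith
  then have "l \<le> 3" using pos unfolding mult_le_cancel2 by simp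
  then consider "l = 3" | "l = 2" using assms(1) by linarith
  then show ?thesis
  proof cases
    case 1
    then have le: "2 * (m * n) \<le> 3 * m + 3 * n" using ge by simp
    then have "m * n \<le> 3 * n" using assms(3) by linarith
    then have "m \<le> 3" using pos unfolding mult_le_cancel2 by simp
    then have "m = 3" using 1 assms(2) by simp
    then show ?thesis using le 1 assms(3) by simp
  next
    case 2
    then have le: "m * n \<le> 2 * m + 2 * n" using ge by simp
    then have "m * n \<le> 4 * n" using assms(3) by linarith
    then have "m \<le> 4" using pos unfolding mult_le_cancel2 by simp
    then consider "m = 2" | "m = 3" | "m = 4" using 2 assms(2) by linarith
    then show ?thesis
    proof cases
      case 1 then show ?thesis using 2 by simp
    next
      assume m: "m = 3"
      then have "n \<le> 6" "3 \<le> n" using le assms(3) by simp_all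
      then have "n = 3 \<or> n = 4 \<or> n = 5 \<or> n = 6" by linarith
      then show ?thesis using 2 m by simp
    next
      assume m: "m = 4"
      then have "n = 4" using le assms(3) by simp
      then show ?thesis using 2 m by simp
    qed
  qed
qed

lemma tame_if_sorted:
  assumes "2 \<le> l" "l \<le> m" "m \<le> n" and ge: "l * m * n \<le> m * n + l * n + l * m"
    and R: "triangle_isoms a b c l m n"
  shows "tame {a, b, c}"
proof -
  from nonhyperbolic_sorted[OF assms(1-4)]
  consider "l = 2" "m = 2" | "l = 2" "m = 3" "n = 3" | "l = 2" "m = 3" "n = 4" | "l = 2" "m = 3" "n = 5"
    | "l = 2" "m = 3" "n = 6" | "l = 2" "m = 4" "n = 4" | "l = 3" "m = 3" "n = 3" by blast
  then show ?thesis
  proof cases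
    case 1 then show ?thesis using tame_22n R assms by simp
  next
    case 2 then show ?thesis using tame_233 R by simp
  next
    case 3 then show ?thesis using tame_index_two[of a b c 2] tame_233 R by simp
  next
    case 4 then show ?thesis using tame_235 R by simp
  next
    case 5 then show ?thesis using tame_index_two[of a b c 3] tame_333 R by simp
  next
    case 6 then show ?thesis using tame_244 R by simp
  next
    case 7 then show ?thesis using tame_333 R by simp
  qed
qed

lemma tame_if_not_hyperbolic:
  assumes "2 \<le> l" "2 \<le> m" "2 \<le> n" and ge: "l * m * n \<le> m * n + l * n + l * m"
    and R: "triangle_isoms a b c l m n"
  shows "tame {a, b, c}"
proof -
  note S = triangle_isoms_swap
  have perm: "{c, b, a} = {a, b, c}" "{b, a, c} = {a, b, c}" "{b, c, a} = {a, b, c}" "{c, a, b} = {a, b, c}" "{a, c, b} = {a, b, c}" by blast+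
  have ge': "m * l * n \<le> m * n + l * n + l * m" "l * n * m \<le> m * n + l * n + l * m"
     "n * l * m \<le> m * n + l * n + l * m" "m * n * l \<le> m * n + l * n + l * m" "n * m * l \<le> m * n + l * n + l * m"
    using ge by (simp_all add: mult_ac)
  consider "l \<le> m" "m \<le> n" | "l \<le> n" "n \<le> m" | "m \<le> l" "l \<le> n" | "m \<le> n" "n \<le> l" | "n \<le> l" "l \<le> m" | "n \<le> m" "m \<le> l"
    by linarith
  then show ?thesis
  proof cases
    case 1 then show ?thesis using tame_if_sorted[OF assms(1) _ _ ge R] by simp
  next
    case 2
    then show ?thesis using tame_if_sorted[OF assms(1) _ _ _ S(2)[OF R]] ge' by (simp add: perm mult_ac add_ac)
  next
    case 3
    then show ?thesis using tame_if_sorted[OF assms(2) _ _ _ S(1)[OF R]] ge' by (simp add: perm mult_ac add_ac)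
  next
    case 4
    then show ?thesis using tame_if_sorted[OF assms(2) _ _ _ S(2)[OF S(1)[OF R]]] ge' by (simp add: perm mult_ac add_ac)
  next
    case 5
    then show ?thesis using tame_if_sorted[OF assms(3) _ _ _ S(1)[OF S(2)[OF R]]] ge' by (simp add: perm mult_ac add_ac)
  next
    case 6
    then show ?thesis using tame_if_sorted[OF assms(3) _ _ _ S(2)[OF S(1)[OF S(2)[OF R]]]] ge' by (simp add: perm mult_ac add_ac)
  qed
qed

end

section \<open>Property (NL) for triangle groups\<close>

lemma not_hyperbolic_triangle_nat:
  assumes "2 \<le> l" "2 \<le> m" "2 \<le> n" and "\<not> hyperbolic_triangle l m n"
  shows "l * m * n \<le> m * n + l * n + l * m"
proof -
  have pos: "real l > 0" "real m > 0" "real n > 0" using assms by auto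
  have "pi * 1 \<le> pi * (1 / real l + 1 / real m + 1 / real n)"
    using assms(4) by (simp add: hyperbolic_triangle_def distrib_left)
  then have "1 \<le> 1 / real l + 1 / real m + 1 / real n" using pi_gt_zero by (simp only: mult_le_cancel_left_pos)
  then have "real l * real m * real n * 1 \<le> real l * real m * real n * (1 / real l + 1 / real m + 1 / real n)"
    using pos by (intro mult_left_mono) auto
  also have "\<dots> = real m * real n + real l * real n + real l * real m" using pos by (simp add: field_simps)
  finally have "real (l * m * n) \<le> real (m * n + l * n + l * m)" by simp
  then show ?thesis by (simp only: of_nat_le_iff)
qed

text \<open>Extending the action by the identity outside \<open>X\<close> makes the generators total functions
that satisfy the relations of the triangle group, so that \<open>tame_if_not_hyperbolic\<close> applies.\<close>

lemma property_NL_if_not_hyperbolic: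
  assumes l: "2 \<le> l" and m: "2 \<le> m" and n: "2 \<le> n" and nonhyp: "\<not> hyperbolic_triangle l m n"
  shows "property_NL TYPE('x) (triangle_group l m n)"
  unfolding property_NL_def
proof (intro allI impI ballI notI)
  fix X :: "'x set" and d \<phi> g
  assume hyp: "hyperbolic_space X d" and act: "isometric_action (triangle_group l m n) X d \<phi>"
    and g: "g \<in> carrier (triangle_group l m n)" and lox: "loxodromic (triangle_group l m n) X d \<phi> g"
  define R where "R = triangle_relators l m n"
  define G where "G = presented_group R"
  have GT: "triangle_group l m n = G" by (simp add: G_def R_def triangle_group_def)
  note act = act[unfolded GT] and g = g[unfolded GT] and lox = lox[unfolded GT]
  obtain x0 C where x0: "x0 \<in> X" and C: "C \<ge> 1"
    "\<And>a b. 1 / C * \<bar>real_of_int a - real_of_int b\<bar> - C \<le> d (\<phi> (g [^]\<^bsub>G\<^esub> a) x0) (\<phi> (g [^]\<^bsub>G\<^esub> b) x0)"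
    using lox unfolding loxodromic_def quasi_isometric_embedding_def dist_real_def by auto
  obtain K where "four_point X d K" using four_point_if_hyperbolic_space[OF hyp] by blast
  moreover have "Metric_space X d" using hyp by (simp add: hyperbolic_space_def geodesic_space_def)
  ultimately interpret four_point_space X d K x0
    using x0 by (simp add: four_point_space_def four_point_space_axioms_def)
  interpret A: group_action G X \<phi> using act by (simp add: isometric_action_def)
  interpret G: group G unfolding G_def by (rule group_presented_group)
  define F where "F h x = (if x \<in> X then \<phi> h x else x)" for h x
  have mem: "\<phi> h x \<in> X" if "h \<in> carrier G" "x \<in> X" for h x
    using A.element_image that by blast
  have F_mult: "F (h \<otimes>\<^bsub>G\<^esub> h') = F h \<circ> F h'" if "h \<in> carrier G" "h' \<in> carrier G" for h h'
    using that A.composition_rule mem by (auto simp: F_def fun_eq_iff)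
  have F_one: "F \<one>\<^bsub>G\<^esub> = id" by (auto simp: F_def fun_eq_iff simp flip: A.id_eq_one)
  have isom_F: "isom (F h)" if "h \<in> carrier G" for h
    using that act mem by (simp add: isom_def F_def isometric_action_def)
  define cl where "cl w = word_rel R `` {w}" for w
  have cl: "cl w \<in> carrier G" for w by (simp add: cl_def G_def)
  have F_append: "F (cl (u @ v)) = F (cl u) \<circ> F (cl v)" for u v
    using F_mult[OF cl cl, of u v] by (simp add: cl_def G_def presented_group_mult)
  have F_Nil: "F (cl []) = id" using F_one by (simp add: cl_def G_def presented_group_def)
  have cl_eq: "cl u = cl v" if "word_equiv R u v" for u v
    unfolding cl_def by (rule equiv_class_eq[OF equiv_word_rel]) (simp add: word_rel_def that)
  have F_relator: "F (cl r) = id" if "r \<in> R" for r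
    using cl_eq[of r "[]"] word_equiv.relator[OF that, of "[]" "[]"] F_Nil by simp
  have F_power: "F (cl (word_power w k)) = F (cl w) ^^ k" for w k
    by (induction k) (simp_all add: word_power_def F_Nil F_append)
  define \<rho> where "\<rho> s = F (cl [(True, s)])" for s
  have pair: "F (cl [(True, s), (True, s')]) = \<rho> s \<circ> \<rho> s'" for s s'
    using F_append[of "[(True, s)]" "[(True, s')]"] by (simp add: \<rho>_def)
  have invol: "\<rho> s \<circ> \<rho> s = id" for s
  proof -
    have "word_power [(True, s)] 2 \<in> R" by (cases s) (simp_all add: R_def triangle_relators_def Let_def)
    then have "\<rho> s ^^ 2 = id" using F_relator F_power by (metis \<rho>_def)
    then show ?thesis by (simp add: numeral_2_eq_2)
  qed
  have rel: "(\<rho> Gen_a \<circ> \<rho> Gen_b) ^^ l = id" "(\<rho> Gen_b \<circ> \<rho> Gen_c) ^^ m = id" "(\<rho> Gen_a \<circ> \<rho> Gen_c) ^^ n = id"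
    unfolding pair[symmetric] F_power[symmetric]
    by (rule F_relator, simp add: R_def triangle_relators_def Let_def)+
  have R: "triangle_isoms (\<rho> Gen_a) (\<rho> Gen_b) (\<rho> Gen_c) l m n"
    unfolding triangle_isoms_def using invol rel isom_F[OF cl] by (simp add: \<rho>_def)
  have letter: "F (cl [(e, s)]) = \<rho> s" for e s
  proof (cases e)
    case False
    have "F (cl [(False, s)]) \<circ> \<rho> s = F (cl [(False, s), (True, s)])"
      using F_append[of "[(False, s)]" "[(True, s)]"] by (simp add: \<rho>_def)
    also have "\<dots> = id"
      using cl_eq[OF word_equiv.cancel[of R "[]" False s "[]"]] F_Nil by simp
    finally have "F (cl [(False, s)]) \<circ> \<rho> s \<circ> \<rho> s = \<rho> s" by simp
    then show ?thesis using False invol[of s] by (simp add: comp_assoc)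
  qed (simp add: \<rho>_def)
  define S where "S = {\<rho> Gen_a, \<rho> Gen_b, \<rho> Gen_c}"
  have "\<rho> s \<in> S" for s by (cases s) (simp_all add: S_def)
  then have gen: "F (cl w) \<in> gen S" for w
  proof (induction w)
    case (Cons p w)
    obtain e s where p: "p = (e, s)" by fastforce
    have "F (cl (p # w)) = \<rho> s \<circ> F (cl w)" using F_append[of "[p]" w] letter by (simp add: p)
    then show ?case using Cons gen_step by metis
  qed (simp add: F_Nil gen_id)
  obtain w where w: "g = cl w" using carrier_presented_group_E g unfolding G_def cl_def by blast
  have "tame S" unfolding S_def
    by (rule tame_if_not_hyperbolic[OF l m n not_hyperbolic_triangle_nat[OF l m n nonhyp] R])
  then obtain M where "M \<ge> 1" "slow (F g ^^ M)" using gen[of w] unfolding tame_def w by blast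
  then have "\<not> fast (F g)" by (intro not_fast_if_power_slow)
  moreover have "fast (F g)"
    unfolding fast_def
  proof (intro exI[of _ C] conjI C(1) allI)
    fix k
    have F_pow: "F (g [^]\<^bsub>G\<^esub> k) = F g ^^ k" for k :: nat
      by (induction k) (simp_all add: F_one F_mult g funpow_Suc_right del: funpow.simps(2))
    have "(F g ^^ k) x0 = \<phi> (g [^]\<^bsub>G\<^esub> int k) x0" "x0 = \<phi> (g [^]\<^bsub>G\<^esub> (0 :: int)) x0"
      using F_pow[of k] F_pow[of 0] x0 by (simp_all add: F_def[abs_def] int_pow_int fun_eq_iff) metis+
    then show "real k / C - C \<le> disp (F g ^^ k)"
      using C(2)[of "int k" 0] by (simp add: disp_def commute)
  qed
  ultimately show False by contradiction
qed

theorem theorem4: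
  fixes l m n :: nat and \<iota> :: "real \<Rightarrow> 'x"
  assumes "l \<ge> 2" and "m \<ge> 2" and "n \<ge> 2"
    and "inj \<iota>"
  shows "property_NL TYPE('x) (triangle_group l m n) \<longleftrightarrow> \<not> hyperbolic_triangle l m n"
  using not_property_NL_if_hyperbolic[OF assms(4) _ assms(1,2,3)]
    property_NL_if_not_hyperbolic[OF assms(1,2,3)] by blast

end
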